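(* Let $p$ be an odd prime and let $G$ be a finite $p$-group of nilpotency class at most two and exponent $p$. Let $n=\mathrm{rank}(G/Z(G))$ and $m=\mathrm{rank}([G,G])$. If $f\bigl(\binom{n}{2}-m+1\bigr)<n$, then $G$ is capable.
   Context: A group $G$ is capable if there exists a group $K$ such that $G\cong K/Z(K)$. For $G$ of class at most two and exponent $p$, both $G/Z(G)$ and $[G,G]$ are elementary abelian $p$-groups, and rank denotes the dimension as a vector space over $\mathbb{F}_p$. The function $f$ is defined on positive integers $k$ as follows: write $k=\binom{T}{2}+s$ with integers $T\ge 0$ and $0\le s\le T$; then $f(k)=\binom{T}{3}+\binom{s}{2}$ (this does not depend on the choice of such an expression for $k$). *)

theory Defs
  imports
    "HOL-Algebra.Generated_Groups"
    "HOL-Number_Theory.Residues"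
    "Jordan_Normal_Form.Missing_VectorSpace"
begin

section \<open>Centre, exponent, nilpotency class\<close>

definition group_center :: "('a, 'b) monoid_scheme \<Rightarrow> 'a set" where
  "group_center G = {z \<in> carrier G. \<forall>x\<in>carrier G. z \<otimes>\<^bsub>G\<^esub> x = x \<otimes>\<^bsub>G\<^esub> z}"

text \<open>Only meaningful for groups of bounded exponent, in particular for finite groups.\<close>
definition group_exponent :: "('a, 'b) monoid_scheme \<Rightarrow> nat" where
  "group_exponent G = (LEAST e. 0 < e \<and> (\<forall>x\<in>carrier G. x [^]\<^bsub>G\<^esub> e = \<one>\<^bsub>G\<^esub>))"

text \<open>Indexing starts at \<open>0\<close>, so \<open>lower_central G i\<close> is the term usually written
  \<open>\<gamma>\<close> with index \<open>i + 1\<close>; \<open>lower_central G 1\<close> is \<open>derived G (carrier G)\<close>.\<close>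
primrec lower_central :: "('a, 'b) monoid_scheme \<Rightarrow> nat \<Rightarrow> 'a set" where
  "lower_central G 0 = carrier G"
| "lower_central G (Suc i) = generate G
     (\<Union>h\<in>lower_central G i. \<Union>x\<in>carrier G. {h \<otimes>\<^bsub>G\<^esub> x \<otimes>\<^bsub>G\<^esub> inv\<^bsub>G\<^esub> h \<otimes>\<^bsub>G\<^esub> inv\<^bsub>G\<^esub> x})"

definition nilpotency_class_at_most :: "('a, 'b) monoid_scheme \<Rightarrow> nat \<Rightarrow> bool" where
  "nilpotency_class_at_most G c \<longleftrightarrow> lower_central G c = {\<one>\<^bsub>G\<^esub>}"

lemma lower_central_1: "lower_central G 1 = derived G (carrier G)"
  by (simp add: derived_def)

lemma (in group) group_center_subgroup: "subgroup (group_center G) G"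
proof (rule subgroupI)
  show "group_center G \<subseteq> carrier G" "group_center G \<noteq> {}"
    by (auto simp: group_center_def)
next
  fix a assume a: "a \<in> group_center G"
  have "inv a \<otimes> x = x \<otimes> inv a" if x: "x \<in> carrier G" for x
  proof -
    from a x have ac: "a \<in> carrier G" and c: "a \<otimes> x = x \<otimes> a"
      by (auto simp: group_center_def)
    have "inv a \<otimes> x = inv a \<otimes> (x \<otimes> a) \<otimes> inv a"
      using ac x by (simp add: m_assoc)
    also have "\<dots> = inv a \<otimes> (a \<otimes> x) \<otimes> inv a"
      using c by simp
    also have "\<dots> = x \<otimes> inv a"
      using ac x by (simp add: m_assoc [symmetric])
    finally show ?thesis .
  qed
  with a show "inv a \<in> group_center G"
    by (auto simp: group_center_def)
next
  fix a b assume a: "a \<in> group_center G" and b: "b \<in> group_center G"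
  have "a \<otimes> b \<otimes> x = x \<otimes> (a \<otimes> b)" if x: "x \<in> carrier G" for x
  proof -
    from a b x have "a \<in> carrier G" "b \<in> carrier G" "a \<otimes> x = x \<otimes> a" "b \<otimes> x = x \<otimes> b"
      by (auto simp: group_center_def)
    with x show ?thesis by (metis m_assoc)
  qed
  moreover have "a \<in> carrier G" "b \<in> carrier G"
    using a b unfolding group_center_def by blast+
  then have "a \<otimes> b \<in> carrier G" by simp
  ultimately show "a \<otimes> b \<in> group_center G"
    unfolding group_center_def by blast
qed

lemma (in group) group_center_normal: "group_center G \<lhd> G"
proof (rule normal_invI [OF group_center_subgroup])
  fix x h assume x: "x \<in> carrier G" and h: "h \<in> group_center G"
  then have "x \<otimes> h = h \<otimes> x" "h \<in> carrier G" by (auto simp: group_center_def)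
  with x have "x \<otimes> h \<otimes> inv x = h" by (simp add: m_assoc)
  with h show "x \<otimes> h \<otimes> inv x \<in> group_center G" by simp
qed

lemma (in group) commutator_eq_one_iff:
  assumes "h \<in> carrier G" "x \<in> carrier G"
  shows "h \<otimes> x \<otimes> inv h \<otimes> inv x = \<one> \<longleftrightarrow> h \<otimes> x = x \<otimes> h"
proof -
  have "h \<otimes> x \<otimes> inv h \<otimes> inv x = (h \<otimes> x) \<otimes> inv (x \<otimes> h)"
    using assms by (simp add: m_assoc inv_mult_group)
  then show ?thesis
    using assms by (metis inv_closed inv_equality inv_inv m_closed r_inv)
qed

lemma (in group) nilpotency_class_at_most_2_iff:
  "nilpotency_class_at_most G 2 \<longleftrightarrow> derived G (carrier G) \<subseteq> group_center G"
proof -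
  let ?D = "derived G (carrier G)"
  let ?C = "\<Union>h\<in>?D. \<Union>x\<in>carrier G. {h \<otimes> x \<otimes> inv h \<otimes> inv x}"
  have D: "?D \<subseteq> carrier G" by (rule derived_in_carrier) simp
  have lc: "lower_central G 2 = generate G ?C"
    by (simp add: numeral_2_eq_2 derived_def)
  have "generate G ?C = {\<one>} \<longleftrightarrow> ?C \<subseteq> {\<one>}"
  proof
    show "?C \<subseteq> {\<one>}" if "generate G ?C = {\<one>}"
      using that generate.incl [of _ ?C G] by blast
    show "generate G ?C = {\<one>}" if "?C \<subseteq> {\<one>}"
      using generate_subgroup_incl [OF that triv_subgroup] generate.one [of G ?C] by blast
  qed
  also have "\<dots> \<longleftrightarrow> (\<forall>h\<in>?D. \<forall>x\<in>carrier G. h \<otimes> x \<otimes> inv h \<otimes> inv x = \<one>)"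
    by blast
  also have "\<dots> \<longleftrightarrow> ?D \<subseteq> group_center G"
    using D by (auto simp: group_center_def commutator_eq_one_iff subset_iff)
  finally show ?thesis
    unfolding nilpotency_class_at_most_def lc .
qed


section \<open>Rank of an elementary abelian \<open>p\<close>-group\<close>

text \<open>An abelian group \<open>A\<close> in which all \<open>p\<close>-th powers are trivial, viewed additively as a
  vector space over \<^term>\<open>residue_ring (int p)\<close>: a scalar \<open>c\<close> acts as \<open>x \<mapsto> x [^] c\<close>. The fields
  \<open>mult\<close> and \<open>one\<close> exist only because the record of modules extends that of rings; no
  module axiom refers to them.\<close>
definition power_module :: "('a, 'b) monoid_scheme \<Rightarrow> (int, 'a) module" where
  "power_module A = \<lparr>carrier = carrier A, monoid.mult = monoid.mult A, one = \<one>\<^bsub>A\<^esub>,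
     zero = \<one>\<^bsub>A\<^esub>, add = monoid.mult A, smult = (\<lambda>c x. x [^]\<^bsub>A\<^esub> c)\<rparr>"

definition elementary_rank :: "nat \<Rightarrow> ('a, 'b) monoid_scheme \<Rightarrow> nat" where
  "elementary_rank p A = vectorspace.dim (residue_ring (int p)) (power_module A)"

lemma vectorspace_power_module:
  assumes "comm_group A" and p: "Factorial_Ring.prime p"
    and exp: "\<And>x. x \<in> carrier A \<Longrightarrow> x [^]\<^bsub>A\<^esub> p = \<one>\<^bsub>A\<^esub>"
  shows "vectorspace (residue_ring (int p)) (power_module A)"
proof -
  interpret A: comm_group A by fact
  interpret R: residues_prime p "residue_ring (int p)"
    by (unfold_locales) (rule p, simp)
  have F: "field (residue_ring (int p))" by (rule R.is_field)
  have ab: "abelian_group (power_module A)"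
  proof (rule abelian_groupI)
    fix x assume "x \<in> carrier (power_module A)"
    then show "\<exists>y\<in>carrier (power_module A). y \<oplus>\<^bsub>power_module A\<^esub> x = \<zero>\<^bsub>power_module A\<^esub>"
      by (intro bexI [of _ "inv\<^bsub>A\<^esub> x"]) (auto simp: power_module_def)
  qed (auto simp: power_module_def A.m_ac)
  have pow_mod: "x [^]\<^bsub>A\<^esub> (k mod int p) = x [^]\<^bsub>A\<^esub> k" if x: "x \<in> carrier A" for x k
  proof -
    have 1: "x [^]\<^bsub>A\<^esub> (int p * (k div int p)) = \<one>\<^bsub>A\<^esub>"
      using x exp by (simp add: A.int_pow_pow [symmetric] int_pow_int)
    have "x [^]\<^bsub>A\<^esub> k = x [^]\<^bsub>A\<^esub> (int p * (k div int p) + k mod int p)" by simp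
    also have "\<dots> = x [^]\<^bsub>A\<^esub> (k mod int p)"
      unfolding A.int_pow_mult [OF x] 1 using x by simp
    finally show ?thesis ..
  qed
  have "Module.module (residue_ring (int p)) (power_module A)"
  proof (rule Module.module.intro [OF fieldE(1) [OF F] ab], unfold_locales)
    fix a b :: int and x y
    show "(a \<oplus>\<^bsub>residue_ring (int p)\<^esub> b) \<odot>\<^bsub>power_module A\<^esub> x =
        a \<odot>\<^bsub>power_module A\<^esub> x \<oplus>\<^bsub>power_module A\<^esub> b \<odot>\<^bsub>power_module A\<^esub> x"
      if "x \<in> carrier (power_module A)"
      using that by (simp add: power_module_def residue_ring_def pow_mod A.int_pow_mult)
    show "(a \<otimes>\<^bsub>residue_ring (int p)\<^esub> b) \<odot>\<^bsub>power_module A\<^esub> x =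
        a \<odot>\<^bsub>power_module A\<^esub> (b \<odot>\<^bsub>power_module A\<^esub> x)"
      if "x \<in> carrier (power_module A)"
      using that by (simp add: power_module_def residue_ring_def pow_mod A.int_pow_pow mult.commute)
  qed (auto simp: power_module_def residue_ring_def A.int_pow_distrib)
  then show ?thesis
    by (rule vectorspace.intro) (rule F)
qed

lemma group_exponent_pow:
  assumes "group G" "finite (carrier G)" "x \<in> carrier G"
  shows "x [^]\<^bsub>G\<^esub> group_exponent G = \<one>\<^bsub>G\<^esub>"
proof -
  interpret group G by fact
  have "0 < order G \<and> (\<forall>x\<in>carrier G. x [^]\<^bsub>G\<^esub> order G = \<one>\<^bsub>G\<^esub>)"
    using assms(2) by (auto simp: order_gt_0_iff_finite pow_order_eq_1)
  from LeastI [of "\<lambda>e. 0 < e \<and> (\<forall>x\<in>carrier G. x [^]\<^bsub>G\<^esub> e = \<one>\<^bsub>G\<^esub>)", OF this] assms(3)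
  show ?thesis unfolding group_exponent_def by blast
qed

lemma vectorspace_derived:
  assumes G: "group G" "finite (carrier G)" and p: "Factorial_Ring.prime p"
    and exp: "group_exponent G = p" and cl: "nilpotency_class_at_most G 2"
  shows "vectorspace (residue_ring (int p)) (power_module (G\<lparr>carrier := derived G (carrier G)\<rparr>))"
proof (rule vectorspace_power_module [OF _ p])
  interpret group G by (rule G)
  have sub: "subgroup (derived G (carrier G)) G" by (rule derived_is_subgroup) simp
  have le: "derived G (carrier G) \<subseteq> group_center G"
    using cl by (simp add: nilpotency_class_at_most_2_iff)
  show "comm_group (G\<lparr>carrier := derived G (carrier G)\<rparr>)"
    by (rule group.group_comm_groupI [OF subgroup_imp_group [OF sub]])
      (use le in \<open>auto simp: group_center_def\<close>)
  show "x [^]\<^bsub>G\<lparr>carrier := derived G (carrier G)\<rparr>\<^esub> p = \<one>\<^bsub>G\<lparr>carrier := derived G (carrier G)\<rparr>\<^esub>"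
    if "x \<in> carrier (G\<lparr>carrier := derived G (carrier G)\<rparr>)" for x
    using that le group_exponent_pow [OF G, of x]
    by (auto simp: nat_pow_consistent [symmetric] group_center_def exp)
qed

lemma vectorspace_mod_center:
  assumes G: "group G" "finite (carrier G)" and p: "Factorial_Ring.prime p"
    and exp: "group_exponent G = p" and cl: "nilpotency_class_at_most G 2"
  shows "vectorspace (residue_ring (int p)) (power_module (G Mod group_center G))"
proof (rule vectorspace_power_module [OF _ p])
  interpret group G by (rule G)
  let ?Z = "group_center G"
  interpret Z: normal ?Z G by (rule group_center_normal)
  have le: "derived G (carrier G) \<subseteq> ?Z"
    using cl by (simp add: nilpotency_class_at_most_2_iff)
  show "comm_group (G Mod ?Z)"
  proof (rule group.group_comm_groupI [OF Z.factorgroup_is_group])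
    fix X Y assume "X \<in> carrier (G Mod ?Z)" "Y \<in> carrier (G Mod ?Z)"
    then obtain x y where x: "x \<in> carrier G" "X = ?Z #>\<^bsub>G\<^esub> x" and y: "y \<in> carrier G" "Y = ?Z #>\<^bsub>G\<^esub> y"
      by (auto simp: FactGroup_def RCOSETS_def)
    have "x \<otimes>\<^bsub>G\<^esub> y \<otimes>\<^bsub>G\<^esub> inv\<^bsub>G\<^esub> x \<otimes>\<^bsub>G\<^esub> inv\<^bsub>G\<^esub> y \<in> derived G (carrier G)"
      unfolding derived_def using x y by (intro generate.incl) blast
    with le have c: "x \<otimes>\<^bsub>G\<^esub> y \<otimes>\<^bsub>G\<^esub> inv\<^bsub>G\<^esub> x \<otimes>\<^bsub>G\<^esub> inv\<^bsub>G\<^esub> y \<in> ?Z" by blast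
    have "x \<otimes>\<^bsub>G\<^esub> y = (x \<otimes>\<^bsub>G\<^esub> y \<otimes>\<^bsub>G\<^esub> inv\<^bsub>G\<^esub> x \<otimes>\<^bsub>G\<^esub> inv\<^bsub>G\<^esub> y) \<otimes>\<^bsub>G\<^esub> (y \<otimes>\<^bsub>G\<^esub> x)"
    proof -
      have "inv\<^bsub>G\<^esub> y \<otimes>\<^bsub>G\<^esub> (y \<otimes>\<^bsub>G\<^esub> x) = x"
        using x y by (simp add: m_assoc [symmetric])
      then show ?thesis using x y by (simp add: m_assoc)
    qed
    with c have "x \<otimes>\<^bsub>G\<^esub> y \<in> ?Z #>\<^bsub>G\<^esub> (y \<otimes>\<^bsub>G\<^esub> x)"
      unfolding r_coset_def by blast
    then have "?Z #>\<^bsub>G\<^esub> (y \<otimes>\<^bsub>G\<^esub> x) = ?Z #>\<^bsub>G\<^esub> (x \<otimes>\<^bsub>G\<^esub> y)"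
      using repr_independence x y group_center_subgroup by simp
    then show "X \<otimes>\<^bsub>G Mod ?Z\<^esub> Y = Y \<otimes>\<^bsub>G Mod ?Z\<^esub> X"
      using x y by (simp add: Z.rcos_sum)
  qed
  show "X [^]\<^bsub>G Mod ?Z\<^esub> p = \<one>\<^bsub>G Mod ?Z\<^esub>" if "X \<in> carrier (G Mod ?Z)" for X
  proof -
    from that obtain x where x: "x \<in> carrier G" "X = ?Z #>\<^bsub>G\<^esub> x"
      by (auto simp: FactGroup_def RCOSETS_def)
    then have "X [^]\<^bsub>G Mod ?Z\<^esub> p = ?Z #>\<^bsub>G\<^esub> (x [^]\<^bsub>G\<^esub> p)"
      by (simp add: Z.FactGroup_pow)
    also have "x [^]\<^bsub>G\<^esub> p = \<one>\<^bsub>G\<^esub>"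
      using group_exponent_pow [OF G] x exp by simp
    finally show ?thesis
      using Z.subset by simp
  qed
qed


section \<open>The function \<open>f\<close>\<close>

text \<open>\<open>magidin_f_representation\<close> and \<open>magidin_f_eq\<close> below show that an expression
  of \<open>k\<close> always exists and that the value does not depend on it. The function is
  applied to \<open>(n choose 2) - m + 1\<close> with natural-number subtraction; this does not truncate,
  since for a group of class at most two \<open>[G,G]\<close> is an image of the exterior square
  of \<open>G/Z(G)\<close>, so \<open>m \<le> n choose 2\<close>.\<close>
definition magidin_f :: "nat \<Rightarrow> nat" where
  "magidin_f k = (THE v. \<exists>T s. k = (T choose 2) + s \<and> s \<le> T \<and> v = (T choose 3) + (s choose 2))"

lemma magidin_f_representation: "\<exists>T s. k = (T choose 2) + s \<and> s \<le> T"
proof (induction k)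
  case 0
  show ?case by (intro exI [of _ 0]) simp
next
  case (Suc k)
  then obtain T s where k: "k = (T choose 2) + s" "s \<le> T" by blast
  show ?case
  proof (cases "s = T")
    case True
    with k show ?thesis
      by (intro exI [of _ "Suc T"] exI [of _ 1]) (simp add: numeral_2_eq_2)
  next
    case False
    with k show ?thesis
      by (intro exI [of _ T] exI [of _ "Suc s"]) simp
  qed
qed

lemma magidin_f_eq:
  assumes "s \<le> T"
  shows "magidin_f ((T choose 2) + s) = (T choose 3) + (s choose 2)"
proof -
  have less: "T' = Suc T \<and> s = T \<and> s' = 0"
    if "T < T'" "s \<le> T" "s' \<le> T'" and eq: "(T choose 2) + s = (T' choose 2) + s'"
    for T T' s s' :: nat
  proof -
    have S: "Suc n choose 2 = (n choose 2) + n" for n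
      by (simp add: numeral_2_eq_2)
    have "T' = Suc T"
    proof (rule ccontr)
      assume "T' \<noteq> Suc T"
      with \<open>T < T'\<close> have "Suc (Suc T) \<le> T'" by simp
      then have "Suc (Suc T) choose 2 \<le> T' choose 2" by (rule binomial_right_mono)
      with that show False by (simp add: S)
    qed
    with that show ?thesis by (simp add: S)
  qed
  have S3: "Suc n choose 3 = (n choose 3) + (n choose 2)" for n
    by (simp add: numeral_3_eq_3 numeral_2_eq_2)
  have "v = (T choose 3) + (s choose 2)"
    if "\<exists>T' s'. (T choose 2) + s = (T' choose 2) + s' \<and> s' \<le> T' \<and> v = (T' choose 3) + (s' choose 2)"
    for v
  proof -
    from that obtain T' s' where eq: "(T choose 2) + s = (T' choose 2) + s'" and s': "s' \<le> T'"
      and v: "v = (T' choose 3) + (s' choose 2)" by blast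
    consider "T < T'" | "T' < T" | "T = T'" by linarith
    then show ?thesis
    proof cases
      case 1
      from less [OF 1 assms s' eq] v show ?thesis by (simp add: S3)
    next
      case 2
      from less [OF 2 s' assms eq [symmetric]] v show ?thesis by (simp add: S3)
    qed (use eq v in simp)
  qed
  then show ?thesis
    unfolding magidin_f_def using assms by (intro the_equality) blast+
qed


section \<open>Capable groups\<close>

text \<open>HOL cannot quantify existentially over the type of the elements of \<open>K\<close>. The type of
  signed words over the elements of \<open>G\<close> is large enough: \<open>capableI\<close> below shows that a
  group \<open>K\<close> over an arbitrary type may be used as a witness.\<close>
definition capable :: "('a, 'b) monoid_scheme \<Rightarrow> bool" where
  "capable G \<longleftrightarrow> (\<exists>K :: ('a \<times> bool) list monoid. group K \<and> G \<cong> K Mod group_center K)"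

primrec eval_word :: "('c, 'd) monoid_scheme \<Rightarrow> ('a \<Rightarrow> 'c) \<Rightarrow> ('a \<times> bool) list \<Rightarrow> 'c" where
  "eval_word K t [] = \<one>\<^bsub>K\<^esub>"
| "eval_word K t (a # w) =
     (if snd a then t (fst a) else inv\<^bsub>K\<^esub> t (fst a)) \<otimes>\<^bsub>K\<^esub> eval_word K t w"

lemma (in group) eval_word_append:
  assumes t: "\<And>a. t a \<in> carrier G"
  shows "eval_word G t v \<in> carrier G"
    and "eval_word G t (v @ w) = eval_word G t v \<otimes> eval_word G t w"
proof -
  show c: "eval_word G t v \<in> carrier G" for v
    using t by (induction v) auto
  show "eval_word G t (v @ w) = eval_word G t v \<otimes> eval_word G t w"
    using t c by (induction v) (auto simp: m_assoc)
qed

lemma (in group) generate_range_eval_word: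
  assumes t: "\<And>a. t a \<in> carrier G"
  shows "generate G (range t) \<subseteq> range (eval_word G t)"
proof
  fix x assume "x \<in> generate G (range t)"
  then show "x \<in> range (eval_word G t)"
  proof induction
    case one
    show ?case by (rule image_eqI [of _ _ "[]"]) simp_all
  next
    case (incl h)
    then obtain a where "h = t a" by blast
    with t show ?case by (intro image_eqI [of _ _ "[(a, True)]"]) simp_all
  next
    case (inv h)
    then obtain a where "h = t a" by blast
    with t show ?case by (intro image_eqI [of _ _ "[(a, False)]"]) simp_all
  next
    case (eng h1 h2)
    then obtain v w where "h1 = eval_word G t v" "h2 = eval_word G t w" by blast
    with t show ?case by (intro image_eqI [of _ _ "v @ w"]) (simp_all add: eval_word_append)
  qed
qed

lemma capableI:
  fixes G :: "('a, 'b) monoid_scheme" and K :: "('c, 'd) monoid_scheme"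
  assumes G: "group G" and K: "group K" and iso: "G \<cong> K Mod group_center K"
  shows "capable G"
proof -
  interpret G: group G by fact
  interpret K: group K by fact
  interpret Z: normal "group_center K" K by (rule K.group_center_normal)
  let ?Q = "K Mod group_center K"
  interpret Q: group ?Q by (rule Z.factorgroup_is_group)
  from G.iso_sym [OF iso] obtain h where h: "h \<in> iso ?Q G"
    by (auto simp: is_iso_def)
  have ker_coset: "group_center K #>\<^bsub>K\<^esub> x = \<one>\<^bsub>?Q\<^esub> \<longleftrightarrow> x \<in> group_center K"
    if "x \<in> carrier K" for x
  proof
    show "x \<in> group_center K" if "group_center K #>\<^bsub>K\<^esub> x = \<one>\<^bsub>?Q\<^esub>"
      using K.coset_join1 [OF _ \<open>x \<in> carrier K\<close> K.group_center_subgroup] that by simp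
    show "group_center K #>\<^bsub>K\<^esub> x = \<one>\<^bsub>?Q\<^esub>" if "x \<in> group_center K"
      using K.coset_join2 [OF \<open>x \<in> carrier K\<close> K.group_center_subgroup that] by simp
  qed
  define psi where "psi = h \<circ> (\<lambda>x. group_center K #>\<^bsub>K\<^esub> x)"
  have "(\<lambda>x. group_center K #>\<^bsub>K\<^esub> x) \<in> hom K ?Q" by (rule Z.r_coset_hom_Mod)
  then have psi_hom: "psi \<in> hom K G"
    unfolding psi_def using h by (intro hom_compose) (auto simp: iso_def)
  interpret psi: group_hom K G psi
    by (intro group_hom.intro G K group_hom_axioms.intro psi_hom)
  have psi_surj: "\<exists>x\<in>carrier K. psi x = g" if "g \<in> carrier G" for g
  proof -
    from h that have "g \<in> h ` carrier ?Q" by (auto simp: iso_def bij_betw_def)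
    then show ?thesis by (auto simp: psi_def FactGroup_def RCOSETS_def)
  qed
  have psi_ker: "psi x = \<one>\<^bsub>G\<^esub> \<longleftrightarrow> x \<in> group_center K" if x: "x \<in> carrier K" for x
  proof -
    have q: "group_center K #>\<^bsub>K\<^esub> x \<in> carrier ?Q"
      using x by (auto simp: FactGroup_def RCOSETS_def)
    have h1: "h \<one>\<^bsub>?Q\<^esub> = \<one>\<^bsub>G\<^esub>"
      using h by (intro hom_one [OF _ Q.is_group G]) (auto simp: iso_def)
    have "psi x = \<one>\<^bsub>G\<^esub> \<longleftrightarrow> h (group_center K #>\<^bsub>K\<^esub> x) = h \<one>\<^bsub>?Q\<^esub>"
      by (simp add: psi_def h1 del: one_FactGroup)
    also have "\<dots> \<longleftrightarrow> group_center K #>\<^bsub>K\<^esub> x = \<one>\<^bsub>?Q\<^esub>"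
      using h q Q.one_closed by (auto simp: iso_def bij_betw_def inj_on_def)
    finally show ?thesis using ker_coset [OF x] by simp
  qed
  define t where "t g = (if g \<in> carrier G then SOME x. x \<in> carrier K \<and> psi x = g else \<one>\<^bsub>K\<^esub>)" for g
  have t': "t g \<in> carrier K \<and> psi (t g) = g" if "g \<in> carrier G" for g
    using someI_ex [of "\<lambda>x. x \<in> carrier K \<and> psi x = g"] psi_surj [OF that] that
    by (auto simp: t_def)
  have t: "t g \<in> carrier K" for g
    using t' [of g] by (cases "g \<in> carrier G") (auto simp: t_def)
  define H where "H = generate K (range t)"
  have H: "subgroup H K"
    unfolding H_def by (rule K.generate_is_subgroup) (use t in blast)
  interpret H: subgroup H K by (rule H)
  have tH: "t g \<in> H" for g
    unfolding H_def by (rule generate.incl) simp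
  have H_center: "x \<in> group_center K"
    if x: "x \<in> H" and comm: "\<And>y. y \<in> H \<Longrightarrow> x \<otimes>\<^bsub>K\<^esub> y = y \<otimes>\<^bsub>K\<^esub> x" for x
  proof -
    have xK: "x \<in> carrier K" using x H.subset by blast
    have "x \<otimes>\<^bsub>K\<^esub> k = k \<otimes>\<^bsub>K\<^esub> x" if k: "k \<in> carrier K" for k
    proof -
      define y where "y = t (psi k)"
      have y: "y \<in> carrier K" "psi y = psi k" "y \<in> H"
        using t' [of "psi k"] k tH by (auto simp: y_def)
      define z where "z = inv\<^bsub>K\<^esub> y \<otimes>\<^bsub>K\<^esub> k"
      have zK: "z \<in> carrier K" using y k by (simp add: z_def)
      have "psi z = \<one>\<^bsub>G\<^esub>" using y k by (simp add: z_def)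
      then have z: "z \<in> group_center K" using psi_ker [OF zK] by simp
      have ky: "k = y \<otimes>\<^bsub>K\<^esub> z" using y k by (simp add: z_def K.m_assoc [symmetric])
      have "x \<otimes>\<^bsub>K\<^esub> k = (y \<otimes>\<^bsub>K\<^esub> x) \<otimes>\<^bsub>K\<^esub> z"
        using xK y zK comm [OF y(3)] by (simp add: ky K.m_assoc [symmetric])
      also have "\<dots> = y \<otimes>\<^bsub>K\<^esub> (z \<otimes>\<^bsub>K\<^esub> x)"
      proof -
      have "z \<otimes>\<^bsub>K\<^esub> x = x \<otimes>\<^bsub>K\<^esub> z" using z xK unfolding group_center_def by blast
      then show ?thesis using xK y zK by (simp add: K.m_assoc)
    qed
      also have "\<dots> = k \<otimes>\<^bsub>K\<^esub> x"
        using xK y zK by (simp add: ky K.m_assoc)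
      finally show ?thesis .
    qed
    with xK show ?thesis unfolding group_center_def by blast
  qed
  define e where "e x = (SOME w. eval_word K t w = x)" for x
  have ev: "eval_word K t (e x) = x" if "x \<in> H" for x
    using K.generate_range_eval_word [of t] t that someI_ex [of "\<lambda>w. eval_word K t w = x"]
    unfolding H_def e_def by blast
  define L :: "('a \<times> bool) list monoid" where
    "L = \<lparr>carrier = e ` H,
       monoid.mult = (\<lambda>v w. e (eval_word K t v \<otimes>\<^bsub>K\<^esub> eval_word K t w)), one = e \<one>\<^bsub>K\<^esub>\<rparr>"
  have L: "group L"
  proof (rule groupI)
    fix x assume "x \<in> carrier L"
    then obtain a where "a \<in> H" "x = e a" by (auto simp: L_def)
    then show "\<exists>y\<in>carrier L. y \<otimes>\<^bsub>L\<^esub> x = \<one>\<^bsub>L\<^esub>"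
      by (intro bexI [of _ "e (inv\<^bsub>K\<^esub> a)"]) (auto simp: L_def ev)
  qed (auto simp: L_def ev K.m_assoc)
  define phi where "phi = psi \<circ> eval_word K t"
  have phi_hom: "phi \<in> hom L G"
    by (auto simp: hom_def phi_def L_def ev)
  interpret phi: group_hom L G phi
    by (intro group_hom.intro G L group_hom_axioms.intro phi_hom)
  have surj: "phi ` carrier L = carrier G"
  proof
    show "carrier G \<subseteq> phi ` carrier L"
    proof
      fix g assume "g \<in> carrier G"
      then have "phi (e (t g)) = g" using t' tH by (simp add: phi_def ev)
      moreover have "e (t g) \<in> carrier L" using tH by (simp add: L_def)
      ultimately show "g \<in> phi ` carrier L" by (metis imageI)
    qed
  qed auto
  have ker: "kernel L G phi = group_center L"
  proof (intro equalityI subsetI)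
    fix w assume "w \<in> kernel L G phi"
    then obtain x where x: "x \<in> H" "w = e x" and "psi x = \<one>\<^bsub>G\<^esub>"
      by (auto simp: kernel_def phi_def L_def ev)
    then have "x \<in> group_center K" using psi_ker by simp
    then have comm: "x \<otimes>\<^bsub>K\<^esub> y = y \<otimes>\<^bsub>K\<^esub> x" if "y \<in> H" for y
      using that H.subset unfolding group_center_def by blast
    have "w \<otimes>\<^bsub>L\<^esub> v = v \<otimes>\<^bsub>L\<^esub> w" if "v \<in> carrier L" for v
    proof -
      from that obtain y where y: "y \<in> H" "v = e y" by (auto simp: L_def)
      then show ?thesis using x comm [OF y(1)] by (simp only: L_def monoid.simps ev)
    qed
    moreover have "w \<in> carrier L" using x by (simp add: L_def)
    ultimately show "w \<in> group_center L"
      unfolding group_center_def by blast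
  next
    fix w assume "w \<in> group_center L"
    then obtain x where x: "x \<in> H" "w = e x"
      and c: "\<And>y. y \<in> H \<Longrightarrow> e (x \<otimes>\<^bsub>K\<^esub> y) = e (y \<otimes>\<^bsub>K\<^esub> x)"
    proof -
      from \<open>w \<in> group_center L\<close> obtain x where x: "x \<in> H" "w = e x"
        by (auto simp: group_center_def L_def)
      have "e (x \<otimes>\<^bsub>K\<^esub> y) = e (y \<otimes>\<^bsub>K\<^esub> x)" if y: "y \<in> H" for y
      proof -
        have "e y \<in> carrier L" using y by (simp add: L_def)
        with \<open>w \<in> group_center L\<close> have "w \<otimes>\<^bsub>L\<^esub> e y = e y \<otimes>\<^bsub>L\<^esub> w"
          unfolding group_center_def by blast
        then show ?thesis by (simp only: L_def monoid.simps ev x y)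
      qed
      with x that show thesis by blast
    qed
    have "x \<otimes>\<^bsub>K\<^esub> y = y \<otimes>\<^bsub>K\<^esub> x" if "y \<in> H" for y
      using arg_cong [OF c [OF that], of "eval_word K t"] x that by (simp add: ev)
    then have "x \<in> group_center K" by (intro H_center x) auto
    then have "psi x = \<one>\<^bsub>G\<^esub>" using psi_ker x by simp
    with x show "w \<in> kernel L G phi"
      by (auto simp: kernel_def phi_def L_def ev)
  qed
  have "L Mod group_center L \<cong> G"
    using phi.FactGroup_iso [OF surj] unfolding ker .
  moreover have "group (L Mod group_center L)"
    by (intro normal.factorgroup_is_group group.group_center_normal L)
  ultimately have "G \<cong> L Mod group_center L"
    by (rule group.iso_sym [rotated])
  with L show ?thesis unfolding capable_def by blast
qed

end

(* Let v be a nontrivial central element. If some central extension of G has a lift of v that is not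
   central, for every such v, then the fibre product of these extensions over G is a group K with
   K / Z(K) isomorphic to G. Extensions by the cyclic group of order p are built from an explicit
   cocycle, whose data are characters \<chi> k of Z(G), one for every basis element x k of G / Z(G),
   subject to a Jacobi identity; the lift of v is central only if all \<chi> k vanish at v.

   If no such data detect v, then linear duality yields n independent alternating 3-tensors all of
   whose contractions lie in the space X' of relations between the commutators of basis elements
   modulo v. This space has dimension at most (n choose 2) - m + 1. Passing to leading terms turns X'
   into a graph with at most that many edges and the tensors into n distinct triangles, whereas
   a graph with k edges has at most f(k) triangles (Kruskal-Katona). *)
theory Submission
  imports Defs "HOL-Library.Nat_Bijection"
begin

section \<open>Triangles in a graph\<close>

text \<open>Linear algebra over the field with \<open>p\<close> elements is carried by
  integer-valued functions that are additive modulo \<open>p\<close>, and dimensions are read off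
  from cardinalities \<open>p ^ k\<close>. The obstacle for the cocycle is that a character \<chi> k
  of the centre need not extend to a homomorphism on \<open>G\<close>. It does extend to the
  additive group of the Lie ring of \<open>G\<close>, which has the same elements; seen from
  \<open>G\<close>, twice this extension is additive up to the value of \<chi> k on a commutator.
  That defect, paired with the coordinates of G / Z(G), has to be a coboundary. This is what the
  Jacobi identity secures, in the form of a tensor \<open>S\<close> symmetric in its last two
  indices. The tensors of the second half are independent because contracting the
  \<open>l\<close>-th one at \<open>q\<close> gives \<open>v\<close> for \<open>l = q\<close> and
  zero otherwise; part of their alternation comes from letting \<open>S\<close> vary while all
  \<chi> k are zero. The summand 1 in the hypothesis is the price of \<open>v\<close>: dividing it
  out lowers the rank of [G,G] by at most one.\<close>

lemma choose_two_add: "(x + y) choose 2 = (x choose 2) + (y choose 2) + x * y"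
proof (induction y)
  case (Suc y)
  have S: "Suc n choose 2 = (n choose 2) + n" for n
    by (simp add: numeral_2_eq_2)
  from Suc show ?case by (simp add: S)
qed simp

text \<open>At \<open>s = T\<close> the next expression starts over from \<open>Suc T\<close> and
  the value stays the same; otherwise \<open>s\<close> grows by one.\<close>

lemma magidin_f_mono: "mono magidin_f"
proof (rule monoI, erule lift_Suc_mono_le [rotated])
  fix k
  obtain T s where k: "k = (T choose 2) + s" "s \<le> T"
    using magidin_f_representation by blast
  show "magidin_f k \<le> magidin_f (Suc k)"
  proof (cases "s = T")
    case True
    then have "Suc k = (Suc T choose 2) + 1" using k by (simp add: numeral_2_eq_2)
    then have "magidin_f (Suc k) = (Suc T choose 3) + (1 choose 2)"
      using magidin_f_eq [of 1 "Suc T"] by simp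
    moreover have "magidin_f k = (T choose 3) + (T choose 2)"
      using magidin_f_eq [of s T] k True by simp
    ultimately show ?thesis by (simp add: numeral_3_eq_3 numeral_2_eq_2)
  next
    case False
    then have "magidin_f (Suc k) = (T choose 3) + (Suc s choose 2)"
      using magidin_f_eq [of "Suc s" T] k by simp
    moreover have "s choose 2 \<le> Suc s choose 2" by (simp add: numeral_2_eq_2)
    ultimately show ?thesis using magidin_f_eq [of s T] k by simp
  qed
qed

text \<open>Numerical form of deleting a vertex of degree \<open>d\<close>: \<open>d\<close> edges
  go, and at most \<open>d choose 2\<close> triangles with them. For \<open>d \<le> s\<close> the
  loss is taken from \<open>s choose 2\<close>, which is superadditive in \<open>s\<close>;
  otherwise \<open>T\<close> drops by one and the claim reduces to
  \<open>w * s \<le> w * d\<close>.\<close>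

lemma magidin_f_diff:
  assumes k: "Suc d choose 2 \<le> k"
  shows "magidin_f (k - d) + (d choose 2) \<le> magidin_f k"
proof (cases "k = 0")
  case True
  with k have "d = 0" by (simp add: numeral_2_eq_2)
  with True show ?thesis by simp
next
  case False
  have S: "Suc n choose 2 = (n choose 2) + n" for n
    by (simp add: numeral_2_eq_2)
  \<comment> \<open>An expression with \<open>s = T\<close> is replaced by the one with
    \<open>Suc T\<close> and remainder 0; the strict inequality is what yields
    \<open>d < T\<close>.\<close>
  obtain T s where Ts: "k = (T choose 2) + s" "s < T"
  proof -
    obtain T s where *: "k = (T choose 2) + s" "s \<le> T"
      using magidin_f_representation by blast
    show ?thesis
      by (cases "s = T") (use * False that [of "Suc T" 0] that [of T s] in \<open>auto simp: S\<close>)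
  qed
  have "d < T"
  proof (rule ccontr)
    assume "\<not> d < T"
    then have "Suc T choose 2 \<le> Suc d choose 2" by (intro binomial_right_mono) simp
    with k Ts show False by (simp add: S)
  qed
  have fk: "magidin_f k = (T choose 3) + (s choose 2)"
    using magidin_f_eq [of s T] Ts by simp
  show ?thesis
  proof (cases "d \<le> s")
    case True
    then have "magidin_f (k - d) = (T choose 3) + ((s - d) choose 2)"
      using magidin_f_eq [of "s - d" T] Ts by simp
    with fk True choose_two_add [of "s - d" d] show ?thesis by simp
  next
    case False
    obtain w where w: "T = Suc (w + d)" using \<open>d < T\<close> by (metis add.commute less_imp_Suc_add)
    have "k - d = ((w + d) choose 2) + (w + s)" using Ts False by (simp add: w S)
    then have "magidin_f (k - d) = ((w + d) choose 3) + ((w + s) choose 2)"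
      using magidin_f_eq [of "w + s" "w + d"] False by simp
    moreover have "T choose 3 = ((w + d) choose 3) + ((w + d) choose 2)"
      by (simp add: w numeral_3_eq_3 numeral_2_eq_2)
    moreover have "w * s \<le> w * d" using False by simp
    ultimately show ?thesis using fk by (simp add: choose_two_add)
  qed
qed

definition triangles :: "'a set set \<Rightarrow> 'a set set" where
  "triangles E = {t. card t = 3 \<and> (\<forall>e. e \<subseteq> t \<and> card e = 2 \<longrightarrow> e \<in> E)}"

lemma triangles_subset_Pow: "triangles E \<subseteq> Pow (\<Union>E)"
proof (intro subsetI PowI)
  fix t x assume t: "t \<in> triangles E" and x: "x \<in> t"
  then have "card (t - {x}) = 2" by (simp add: triangles_def)
  then have "t - {x} \<noteq> {}" by (metis card.empty zero_neq_numeral)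
  then obtain y where "y \<in> t - {x}" by blast
  with t x have "{x, y} \<in> E" by (auto simp: triangles_def)
  then show "x \<in> \<Union>E" by blast
qed

text \<open>Removing a vertex of minimal degree \<open>d\<close> destroys at most \<open>d choose 2\<close> triangles, and
  minimality forces at least \<open>Suc d choose 2\<close> edges.\<close>
lemma card_triangles_le:
  fixes E :: "'a set set"
  assumes "finite E" "\<And>e. e \<in> E \<Longrightarrow> card e = 2"
  shows "card (triangles E) \<le> magidin_f (card E)"
  using assms
proof (induction "card E" arbitrary: E rule: less_induct)
  case less
  define V where "V = \<Union>E"
  have fin_e: "finite e" if "e \<in> E" for e
    using less.prems(2) [OF that] by (intro card_ge_0_finite) simp
  then have finV: "finite V" using less.prems(1) by (auto simp: V_def)
  show ?case
  proof (cases "E = {}")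
    case True
    then have "triangles E \<subseteq> {{}}" using triangles_subset_Pow [of E] by simp
    then have "triangles E = {}" by (auto simp: triangles_def)
    then show ?thesis by simp
  next
    case False
    define I where "I x = {e \<in> E. x \<in> e}" for x
    have finI: "finite (I x)" for x using less.prems(1) by (simp add: I_def)
    have "V \<noteq> {}" using False less.prems(2) by (fastforce simp: V_def)
    then obtain x where x: "x \<in> V" and min: "\<And>y. y \<in> V \<Longrightarrow> card (I x) \<le> card (I y)"
      using finV ex_is_arg_min_if_finite [of V "\<lambda>y. card (I y)"]
      by (auto simp: is_arg_min_linorder)
    define d where "d = card (I x)"
    define N where "N = {y. {x, y} \<in> E}"
    have x_N: "x \<notin> N" using less.prems(2) [of "{x}"] by (auto simp: N_def)
    have I_eq: "I x = (\<lambda>y. {x, y}) ` N"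
    proof
      show "I x \<subseteq> (\<lambda>y. {x, y}) ` N"
      proof
        fix e assume "e \<in> I x"
        then have e: "e \<in> E" "x \<in> e" by (auto simp: I_def)
        with less.prems(2) obtain y where "e = {x, y}"
          by (auto simp: card_2_iff)
        with e show "e \<in> (\<lambda>y. {x, y}) ` N" by (auto simp: N_def)
      qed
    qed (auto simp: I_def N_def)
    moreover have "inj_on (\<lambda>y. {x, y}) N"
      by (auto simp: inj_on_def doubleton_eq_iff)
    ultimately have cN: "card N = d" by (simp add: d_def card_image)
    have NV: "insert x N \<subseteq> V" using x by (auto simp: N_def V_def)
    then have finN: "finite N" using finite_subset [OF _ finV, of "insert x N"] by simp
    have "d > 0" using x finI [of x] by (auto simp: d_def I_def V_def card_gt_0_iff)
    \<comment> \<open>Handshake count. Minimality of \<open>d\<close>, and \<open>x\<close> with its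
      \<open>d\<close> neighbours as vertices, turn it into
      \<open>Suc d * d \<le> 2 * card E\<close>.\<close>
    have deg: "(\<Sum>y\<in>V. card (I y)) = 2 * card E"
      unfolding I_def
    proof (rule sum_multicount [OF finV less.prems(1)], rule ballI)
      fix e assume e: "e \<in> E"
      then have "{y \<in> V. y \<in> e} = e" by (auto simp: V_def)
      with e less.prems(2) show "card {y \<in> V. y \<in> e} = 2" by simp
    qed
    have "Suc d * d \<le> card V * d"
      using card_mono [OF finV NV] x_N finN cN by (intro mult_right_mono) simp_all
    also have "\<dots> \<le> (\<Sum>y\<in>V. card (I y))"
      using sum_mono [of V "\<lambda>_. d" "\<lambda>y. card (I y)"] min by (simp add: d_def)
    finally have dk: "Suc d choose 2 \<le> card E"
      by (simp add: choose_two deg)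
    define E' where "E' = E - I x"
    have cE': "card E' = card E - d"
      unfolding E'_def d_def by (rule card_Diff_subset [OF finI]) (auto simp: I_def)
    have "0 < card E" using False less.prems(1) by (simp add: card_gt_0_iff)
    then have IH: "card (triangles E') \<le> magidin_f (card E - d)"
      using less.hyps [of E'] less.prems \<open>d > 0\<close> cE' by (auto simp: E'_def)
    define F where "F = {e. e \<subseteq> N \<and> card e = 2}"
    have cF: "card F = d choose 2" unfolding F_def using n_subsets [OF finN] cN by simp
    have finF: "finite F" unfolding F_def using finN by simp
    \<comment> \<open>A triangle through \<open>x\<close> is determined by its opposite edge, a pair
      of neighbours of \<open>x\<close>; every other triangle survives the removal of
      \<open>x\<close>.\<close>
    have sub: "triangles E \<subseteq> triangles E' \<union> insert x ` F"
    proof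
      fix t assume t: "t \<in> triangles E"
      then have ct: "card t = 3" "finite t" by (auto simp: triangles_def intro: card_ge_0_finite)
      have tE: "e \<in> E" if "e \<subseteq> t" "card e = 2" for e using t that by (simp add: triangles_def)
      show "t \<in> triangles E' \<union> insert x ` F"
      proof (cases "x \<in> t")
        case True
        have "{x, y} \<in> E" if "y \<in> t - {x}" for y
          using that True by (intro tE) auto
        then have "t - {x} \<in> F" using True ct by (auto simp: F_def N_def)
        moreover have "t = insert x (t - {x})" using True by blast
        ultimately show ?thesis by blast
      next
        case False
        then show ?thesis using ct tE by (auto simp: triangles_def E'_def I_def)
      qed
    qed
    have "\<Union>E' \<subseteq> V" unfolding V_def E'_def by (rule Union_mono) blast
    then have "triangles E' \<subseteq> Pow V"
      by (rule subset_trans [OF triangles_subset_Pow Pow_mono])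
    then have "finite (triangles E')" by (rule finite_subset) (simp add: finV)
    then have "card (triangles E) \<le> card (triangles E' \<union> insert x ` F)"
      using sub finF by (intro card_mono) auto
    also have "\<dots> \<le> card (triangles E') + card (insert x ` F)" by (rule card_Un_le)
    also have "card (insert x ` F) \<le> d choose 2" using card_image_le [OF finF] cF by metis
    finally show ?thesis using IH magidin_f_diff [OF dk] by simp
  qed
qed

section \<open>Capability from cocycles\<close>

text \<open>Cocycles for the trivial action on the cyclic group of order \<open>p\<close>, with
  integers standing for residues. They are not normalised, so the identity of an extension carries
  the negative of the value at two identities.\<close>

definition two_cocycle :: "nat \<Rightarrow> ('a, 'b) monoid_scheme \<Rightarrow> ('a \<Rightarrow> 'a \<Rightarrow> int) \<Rightarrow> bool" where
  "two_cocycle p G c \<longleftrightarrow> (\<forall>x\<in>carrier G. \<forall>y\<in>carrier G. \<forall>z\<in>carrier G.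
     [c x y + c (x \<otimes>\<^bsub>G\<^esub> y) z = c y z + c x (y \<otimes>\<^bsub>G\<^esub> z)] (mod int p))"

text \<open>The witness is the central extension of \<open>G\<close> by a power of the cyclic group of order \<open>p\<close>
  with one factor, and one cocycle, for every nontrivial central element \<open>v\<close>.\<close>
lemma capable_of_cocycles:
  fixes G :: "('a, 'b) monoid_scheme"
  assumes G: "group G" and p: "p > 0"
    and ex: "\<And>v. v \<in> group_center G \<Longrightarrow> v \<noteq> \<one>\<^bsub>G\<^esub> \<Longrightarrow>
      \<exists>c. two_cocycle p G c \<and> (\<exists>h\<in>carrier G. \<not> [c v h = c h v] (mod int p))"
  shows "capable G"
proof -
  interpret group G by fact
  let ?Z = "group_center G"
  have "\<exists>c. two_cocycle p G c \<and> (v \<in> ?Z \<and> v \<noteq> \<one>\<^bsub>G\<^esub> \<longrightarrow> (\<exists>h\<in>carrier G. \<not> [c v h = c h v] (mod int p)))"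
    for v
  proof (cases "v \<in> ?Z \<and> v \<noteq> \<one>\<^bsub>G\<^esub>")
    case False
    \<comment> \<open>The zero cocycle as a default makes the family total, so that the fibre
      product can be indexed by the whole type.\<close>
    then show ?thesis by (intro exI [of _ "\<lambda>_ _. 0"]) (simp add: two_cocycle_def)
  qed (use ex in blast)
  then obtain c where coc: "\<And>v. two_cocycle p G (c v)"
    and nc: "\<And>v. v \<in> ?Z \<Longrightarrow> v \<noteq> \<one>\<^bsub>G\<^esub> \<Longrightarrow> \<exists>h\<in>carrier G. \<not> [c v v h = c v h v] (mod int p)"
    by metis
  have c: "(c v x y + c v (x \<otimes>\<^bsub>G\<^esub> y) z) mod int p = (c v y z + c v x (y \<otimes>\<^bsub>G\<^esub> z)) mod int p"
    if "x \<in> carrier G" "y \<in> carrier G" "z \<in> carrier G" for v x y z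
    using coc [of v] that by (simp add: two_cocycle_def cong_def)
  have c1: "[c v \<one>\<^bsub>G\<^esub> x = c v \<one>\<^bsub>G\<^esub> \<one>\<^bsub>G\<^esub>] (mod int p)" "[c v x \<one>\<^bsub>G\<^esub> = c v \<one>\<^bsub>G\<^esub> \<one>\<^bsub>G\<^esub>] (mod int p)"
    if "x \<in> carrier G" for v x
    using c [of "\<one>\<^bsub>G\<^esub>" "\<one>\<^bsub>G\<^esub>" x v] c [of x "\<one>\<^bsub>G\<^esub>" "\<one>\<^bsub>G\<^esub>" v] that
    by (simp_all add: cong_def mod_eq_dvd_iff algebra_simps dvd_diff_commute)
  \<comment> \<open>Coordinates are reduced representatives, so that equality in \<open>K\<close> is
    congruence modulo \<open>p\<close> in every coordinate.\<close>
  define K :: "('a \<times> ('a \<Rightarrow> int)) monoid" where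
    "K = \<lparr>carrier = carrier G \<times> {f. \<forall>v. 0 \<le> f v \<and> f v < int p},
       monoid.mult = (\<lambda>(g, f) (h, f'). (g \<otimes>\<^bsub>G\<^esub> h, \<lambda>v. (f v + f' v + c v g h) mod int p)),
       one = (\<one>\<^bsub>G\<^esub>, \<lambda>v. (- c v \<one>\<^bsub>G\<^esub> \<one>\<^bsub>G\<^esub>) mod int p)\<rparr>"
  have mult_K: "(g, f) \<otimes>\<^bsub>K\<^esub> (h, f') = (g \<otimes>\<^bsub>G\<^esub> h, \<lambda>v. (f v + f' v + c v g h) mod int p)" for g f h f'
    by (simp add: K_def)
  have carrier_K: "(g, f) \<in> carrier K \<longleftrightarrow> g \<in> carrier G \<and> (\<forall>v. 0 \<le> f v \<and> f v < int p)" for g f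
    by (simp add: K_def)
  have one_K: "\<one>\<^bsub>K\<^esub> = (\<one>\<^bsub>G\<^esub>, \<lambda>v. (- c v \<one>\<^bsub>G\<^esub> \<one>\<^bsub>G\<^esub>) mod int p)" by (simp add: K_def)
  have mod_lr: "(x mod m + y + z) mod m = (x + y + z) mod m" "(x + y mod m + z) mod m = (x + y + z) mod m"
    for x y z m :: int
    by (metis add.assoc mod_add_left_eq, metis add.assoc add.commute mod_add_left_eq)
  have K: "group K"
  proof (rule groupI)
    fix x y z assume "x \<in> carrier K" "y \<in> carrier K" "z \<in> carrier K"
    moreover obtain g f h f' k f'' where "x = (g, f)" "y = (h, f')" "z = (k, f'')"
      by (cases x, cases y, cases z)
    ultimately show "x \<otimes>\<^bsub>K\<^esub> y \<otimes>\<^bsub>K\<^esub> z = x \<otimes>\<^bsub>K\<^esub> (y \<otimes>\<^bsub>K\<^esub> z)"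
    proof (simp add: mult_K carrier_K m_assoc, intro ext)
      fix v
      assume "g \<in> carrier G \<and> (\<forall>v. 0 \<le> f v \<and> f v < int p)" "h \<in> carrier G \<and> (\<forall>v. 0 \<le> f' v \<and> f' v < int p)"
        "k \<in> carrier G \<and> (\<forall>v. 0 \<le> f'' v \<and> f'' v < int p)"
      then have "[c v g h + c v (g \<otimes>\<^bsub>G\<^esub> h) k = c v h k + c v g (h \<otimes>\<^bsub>G\<^esub> k)] (mod int p)"
        using c [of g h k v] by (simp add: cong_def)
      from cong_add [OF this cong_refl [of "f v + f' v + f'' v"]]
      show "((f v + f' v + c v g h) mod int p + f'' v + c v (g \<otimes>\<^bsub>G\<^esub> h) k) mod int p =
          (f v + (f' v + f'' v + c v h k) mod int p + c v g (h \<otimes>\<^bsub>G\<^esub> k)) mod int p"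
        unfolding mod_lr by (simp add: cong_def ac_simps)
    qed
  next
    fix x assume "x \<in> carrier K"
    moreover obtain g f where x: "x = (g, f)" by (cases x)
    ultimately have g: "g \<in> carrier G" and f: "\<And>v. 0 \<le> f v \<and> f v < int p"
      by (auto simp: carrier_K)
    have "((- c v \<one>\<^bsub>G\<^esub> \<one>\<^bsub>G\<^esub>) mod int p + f v + c v \<one>\<^bsub>G\<^esub> g) mod int p = f v" for v
    proof -
      have "[- c v \<one>\<^bsub>G\<^esub> \<one>\<^bsub>G\<^esub> + f v + c v \<one>\<^bsub>G\<^esub> g = - c v \<one>\<^bsub>G\<^esub> \<one>\<^bsub>G\<^esub> + f v + c v \<one>\<^bsub>G\<^esub> \<one>\<^bsub>G\<^esub>] (mod int p)"
        by (intro cong_add c1 g cong_refl)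
      then show ?thesis using f [of v] unfolding mod_lr by (simp add: cong_def)
    qed
    then show "\<one>\<^bsub>K\<^esub> \<otimes>\<^bsub>K\<^esub> x = x" using g by (simp add: x one_K mult_K)
    have "((((- c v \<one>\<^bsub>G\<^esub> \<one>\<^bsub>G\<^esub> - f v - c v (inv\<^bsub>G\<^esub> g) g) mod int p) + f v + c v (inv\<^bsub>G\<^esub> g) g) mod int p)
        = (- c v \<one>\<^bsub>G\<^esub> \<one>\<^bsub>G\<^esub>) mod int p" for v
      unfolding mod_lr by simp
    then show "\<exists>y\<in>carrier K. y \<otimes>\<^bsub>K\<^esub> x = \<one>\<^bsub>K\<^esub>"
      using g p by (intro bexI [of _ "(inv\<^bsub>G\<^esub> g, \<lambda>v. (- c v \<one>\<^bsub>G\<^esub> \<one>\<^bsub>G\<^esub> - f v - c v (inv\<^bsub>G\<^esub> g) g) mod int p)"])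
        (simp_all add: x one_K mult_K carrier_K)
  qed (use p in \<open>auto simp: K_def\<close>)
  have "fst \<in> hom K G" by (auto simp: hom_def K_def)
  then interpret fst: group_hom K G fst
    by (intro group_hom.intro G K group_hom_axioms.intro)
  have surj: "fst ` carrier K = carrier G"
  proof
    show "carrier G \<subseteq> fst ` carrier K"
      using p by (auto simp: carrier_K intro!: image_eqI [of _ _ "(g, \<lambda>_. 0)" for g])
  qed (auto simp: carrier_K)
  have "kernel K G fst = group_center K"
  proof (intro equalityI subsetI)
    fix x assume "x \<in> kernel K G fst"
    then obtain f where x: "x = (\<one>\<^bsub>G\<^esub>, f)" and xK: "x \<in> carrier K"
      by (cases x) (auto simp: kernel_def)
    have "x \<otimes>\<^bsub>K\<^esub> y = y \<otimes>\<^bsub>K\<^esub> x" if "y \<in> carrier K" for y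
    proof -
      obtain h f' where y: "y = (h, f')" by (cases y)
      with that have h: "h \<in> carrier G" by (simp add: carrier_K)
      have "(f v + f' v + c v \<one>\<^bsub>G\<^esub> h) mod int p = (f' v + f v + c v h \<one>\<^bsub>G\<^esub>) mod int p" for v
      proof -
        have "[f v + f' v + c v \<one>\<^bsub>G\<^esub> h = f v + f' v + c v h \<one>\<^bsub>G\<^esub>] (mod int p)"
          by (intro cong_add cong_refl cong_trans [OF c1(1) [OF h] cong_sym [OF c1(2) [OF h]]])
        then show ?thesis by (simp add: cong_def add.commute)
      qed
      then show ?thesis using h by (simp add: x y mult_K)
    qed
    with xK show "x \<in> group_center K" by (simp add: group_center_def)
  next
    fix x assume xZ: "x \<in> group_center K"
    obtain g f where x: "x = (g, f)" by (cases x)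
    from xZ x have g: "g \<in> carrier G" by (auto simp: group_center_def carrier_K)
    have comm: "g \<otimes>\<^bsub>G\<^esub> h = h \<otimes>\<^bsub>G\<^esub> g \<and> [c v g h = c v h g] (mod int p)" if h: "h \<in> carrier G" for h v
    proof -
      \<comment> \<open>Commuting with an element whose second component is zero says exactly that
        \<open>g\<close> and \<open>h\<close> commute and that each cocycle is symmetric at
        them.\<close>
      have "(h, \<lambda>_. 0) \<in> carrier K" using h p by (simp add: carrier_K)
      with xZ x have eq: "(g, f) \<otimes>\<^bsub>K\<^esub> (h, \<lambda>_. 0) = (h, \<lambda>_. 0) \<otimes>\<^bsub>K\<^esub> (g, f)"
        unfolding group_center_def by blast
      then have "(f v + c v g h) mod int p = (f v + c v h g) mod int p"
        by (simp add: mult_K fun_eq_iff)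
      then have "[c v g h = c v h g] (mod int p)"
        using cong_add_lcancel [of "f v" "c v g h" "c v h g" "int p"] by (simp add: cong_def)
      with eq show ?thesis by (simp add: mult_K)
    qed
    then have "g \<in> ?Z" using g by (simp add: group_center_def)
    \<comment> \<open>A central \<open>g\<close> other than the identity would violate the
      coordinate \<open>v = g\<close>, whose cocycle was chosen to detect it.\<close>
    with comm nc have "g = \<one>\<^bsub>G\<^esub>" by blast
    with x xZ show "x \<in> kernel K G fst" by (auto simp: kernel_def group_center_def)
  qed
  with fst.FactGroup_iso [OF surj] have "K Mod group_center K \<cong> G" by simp
  moreover have "group (K Mod group_center K)"
    by (intro normal.factorgroup_is_group group.group_center_normal K)
  ultimately have "G \<cong> K Mod group_center K"
    by (rule group.iso_sym [rotated])
  with G K show ?thesis by (rule capableI)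
qed

section \<open>Characters of elementary abelian groups\<close>

text \<open>The linear functionals of the development. Values are not reduced to residues, so that
  sums and multiples are formed in the integers; \<open>H\<close> is separate from the carrier, so
  that one function can be considered on several subgroups.\<close>

definition hom_mod :: "nat \<Rightarrow> ('a, 'b) monoid_scheme \<Rightarrow> 'a set \<Rightarrow> ('a \<Rightarrow> int) \<Rightarrow> bool" where
  "hom_mod p G H \<chi> \<longleftrightarrow> (\<forall>x\<in>H. \<forall>y\<in>H. [\<chi> (x \<otimes>\<^bsub>G\<^esub> y) = \<chi> x + \<chi> y] (mod int p))"

lemma hom_mod_add: "hom_mod p G H \<chi> \<Longrightarrow> x \<in> H \<Longrightarrow> y \<in> H \<Longrightarrow> [\<chi> (x \<otimes>\<^bsub>G\<^esub> y) = \<chi> x + \<chi> y] (mod int p)"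
  by (simp add: hom_mod_def)

lemma (in group) hom_mod_one:
  assumes "hom_mod p G H \<chi>" "\<one> \<in> H"
  shows "[\<chi> \<one> = 0] (mod int p)"
  using hom_mod_add [OF assms(1,2,2)] by (simp add: cong_iff_dvd_diff)

lemma (in group) subgroup_pow_closed: "subgroup S G \<Longrightarrow> s \<in> S \<Longrightarrow> s [^] (i::nat) \<in> S"
  by (induction i) (auto intro: subgroup.one_closed subgroup.m_closed)

lemma (in group) hom_mod_pow:
  assumes \<chi>: "hom_mod p G H \<chi>" and H: "subgroup H G" and x: "x \<in> H"
  shows "[\<chi> (x [^] (k::nat)) = int k * \<chi> x] (mod int p)"
proof (induction k)
  case 0
  show ?case using hom_mod_one [OF \<chi>] subgroup.one_closed [OF H] by simp
next
  case (Suc k)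
  have "x [^] k \<in> H" by (rule subgroup_pow_closed [OF H x])
  from cong_trans [OF hom_mod_add [OF \<chi> this x] cong_add [OF Suc cong_refl]]
  show ?case by (simp add: algebra_simps)
qed

locale elementary_abelian = comm_group G for G (structure) +
  fixes p :: nat
  assumes prime_p: "Factorial_Ring.prime p"
    and exponent_p: "x \<in> carrier G \<Longrightarrow> x [^] p = \<one>"
    and finite_carrier: "finite (carrier G)"
begin

text \<open>For a subgroup \<open>S\<close>, the subgroup generated by \<open>S\<close> and
  \<open>y\<close>; natural exponents suffice as the inverse of \<open>y\<close> is
  \<open>y [^] (p - 1)\<close>.\<close>

definition adjoin :: "'a set \<Rightarrow> 'a \<Rightarrow> 'a set" where
  "adjoin S y = {s \<otimes> y [^] (i::nat) | s i. s \<in> S}"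

lemma pow_mult_p: "y \<in> carrier G \<Longrightarrow> y [^] (p * i) = \<one>"
  by (simp add: nat_pow_pow [symmetric] exponent_p)

lemma subgroup_adjoin:
  assumes S: "subgroup S G" and y: "y \<in> carrier G"
  shows "subgroup (adjoin S y) G"
proof -
  interpret S: subgroup S G by fact
  show ?thesis
  proof (rule subgroupI)
    show "adjoin S y \<subseteq> carrier G" using y by (auto simp: adjoin_def)
    show "adjoin S y \<noteq> {}" unfolding adjoin_def using S.one_closed by blast
  next
    fix a assume "a \<in> adjoin S y"
    then obtain s i where a: "a = s \<otimes> y [^] (i::nat)" and s: "s \<in> S" by (auto simp: adjoin_def)
    have ac4: "u \<otimes> v \<otimes> (w \<otimes> z) = (u \<otimes> w) \<otimes> (v \<otimes> z)"
      if "u \<in> carrier G" "v \<in> carrier G" "w \<in> carrier G" "z \<in> carrier G" for u v w z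
      using that by (simp add: m_ac)
    have "inv s \<otimes> y [^] ((p - 1) * i) \<otimes> (s \<otimes> y [^] i) = (inv s \<otimes> s) \<otimes> (y [^] ((p - 1) * i) \<otimes> y [^] i)"
      using s y by (intro ac4) auto
    also have "\<dots> = y [^] ((p - 1) * i + i)"
      using s y by (simp add: nat_pow_mult)
    also have "(p - 1) * i + i = p * i"
      using prime_gt_0_nat [OF prime_p] by (simp add: mult_eq_if)
    finally have "inv s \<otimes> y [^] ((p - 1) * i) \<otimes> a = \<one>"
      using y by (simp add: pow_mult_p a)
    then have "inv a = inv s \<otimes> y [^] ((p - 1) * i)"
      using s y a by (intro inv_equality) auto
    then show "inv a \<in> adjoin S y" using s unfolding adjoin_def by blast
  next
    fix a b assume "a \<in> adjoin S y" "b \<in> adjoin S y"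
    then obtain s i t j where a: "a = s \<otimes> y [^] (i::nat)" "s \<in> S" and b: "b = t \<otimes> y [^] (j::nat)" "t \<in> S"
      by (auto simp: adjoin_def)
    then have "a \<otimes> b = (s \<otimes> t) \<otimes> y [^] (i + j)"
      using y by (simp add: nat_pow_mult [symmetric] m_ac)
    then show "a \<otimes> b \<in> adjoin S y" using a b unfolding adjoin_def by blast
  qed
qed

lemma pow_mod_p:
  assumes y: "y \<in> carrier G"
  shows "y [^] (i mod p) = y [^] i"
proof -
  have "y [^] i = y [^] (p * (i div p) + i mod p)" by simp
  also have "\<dots> = y [^] (i mod p)"
    using y unfolding nat_pow_mult [OF y, symmetric] pow_mult_p [OF y] by simp
  finally show ?thesis ..
qed

lemma subset_adjoin: "subgroup S G \<Longrightarrow> y \<in> carrier G \<Longrightarrow> S \<subseteq> adjoin S y"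
proof
  fix s assume S: "subgroup S G" and s: "s \<in> S" and y: "y \<in> carrier G"
  then have "s = s \<otimes> y [^] (0::nat)" by (simp add: subgroup.mem_carrier)
  with s show "s \<in> adjoin S y" unfolding adjoin_def by blast
qed

lemma mem_adjoin: "subgroup S G \<Longrightarrow> y \<in> carrier G \<Longrightarrow> y \<in> adjoin S y"
proof -
  assume S: "subgroup S G" and y: "y \<in> carrier G"
  then have "y = \<one> \<otimes> y [^] (1::nat)" by simp
  with subgroup.one_closed [OF S] show ?thesis unfolding adjoin_def by blast
qed

lemma adjoin_subset: "subgroup T G \<Longrightarrow> S \<subseteq> T \<Longrightarrow> y \<in> T \<Longrightarrow> adjoin S y \<subseteq> T"
proof
  fix a assume T: "subgroup T G" "S \<subseteq> T" "y \<in> T" and "a \<in> adjoin S y"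
  then obtain s i where "a = s \<otimes> y [^] (i::nat)" "s \<in> S" by (auto simp: adjoin_def)
  with T subgroup_pow_closed [of T y i] show "a \<in> T" by (simp add: subgroup.m_closed subsetD)
qed

text \<open>Otherwise \<open>k\<close> would be invertible modulo \<open>p\<close> and
  \<open>y\<close> would be a power of \<open>y [^] k\<close>.\<close>

lemma pow_in_subgroup:
  assumes S: "subgroup S G" and y: "y \<in> carrier G" "y \<notin> S" and k: "y [^] (k::nat) \<in> S"
  shows "p dvd k"
proof (rule ccontr)
  assume "\<not> p dvd k"
  then have "coprime k p"
    using prime_p by (metis prime_imp_coprime coprime_commute)
  then obtain u where u: "[k * u = 1] (mod p)" using cong_solve_coprime_nat [of k p] by auto
  have p1: "1 mod p = 1" using prime_gt_1_nat [OF prime_p] by simp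
  have "y [^] (k * u) = y"
    using pow_mod_p [OF y(1), of "k * u"] y u p1 by (simp add: cong_def)
  then have "(y [^] k) [^] u = y" using y by (simp add: nat_pow_pow)
  with subgroup_pow_closed [OF S k, of u] y show False by simp
qed

text \<open>Cancelling puts the power of \<open>y\<close> with the difference of the exponents into
  \<open>S\<close>. The second conclusion is the implication from equal exponents to equal parts in
  \<open>S\<close>.\<close>

lemma adjoin_unique:
  assumes S: "subgroup S G" and y: "y \<in> carrier G" "y \<notin> S"
    and st: "s \<in> S" "t \<in> S" and eq: "s \<otimes> y [^] (i::nat) = t \<otimes> y [^] (j::nat)"
  shows "[i = j] (mod p)" and "s = t \<or> i \<noteq> j"
proof -
  interpret S: subgroup S G by fact
  have wlog: "[i = j] (mod p)"
    if "i \<le> j" "s \<in> S" "t \<in> S" "s \<otimes> y [^] i = t \<otimes> y [^] j" for s t i j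
  proof -
    have "y [^] j = y [^] (j - i) \<otimes> y [^] i" using that y by (simp add: nat_pow_mult)
    with that y have "s \<otimes> y [^] i = (t \<otimes> y [^] (j - i)) \<otimes> y [^] i" by (simp add: m_assoc)
    then have "s = t \<otimes> y [^] (j - i)" using that y by (simp add: S.mem_carrier)
    then have "inv t \<otimes> s = y [^] (j - i)" using that y by (simp add: m_assoc [symmetric] S.mem_carrier)
    then have "y [^] (j - i) \<in> S" using that by (metis S.m_closed S.m_inv_closed)
    then have "p dvd j - i" by (rule pow_in_subgroup [OF S y])
    then show ?thesis using that(1) by (metis cong_altdef_nat cong_sym)
  qed
  show "[i = j] (mod p)"
    using wlog [of i j s t] wlog [of j i t s] st eq by (metis cong_sym nat_le_linear)
  show "s = t \<or> i \<noteq> j" using st eq y by (auto simp: S.mem_carrier)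
qed

lemma card_adjoin:
  assumes S: "subgroup S G" and y: "y \<in> carrier G" "y \<notin> S"
  shows "card (adjoin S y) = p * card S"
proof -
  interpret S: subgroup S G by fact
  have inj: "inj_on (\<lambda>(s, i). s \<otimes> y [^] i) (S \<times> {..<p})"
  proof (rule inj_onI, clarsimp)
    fix s i t j assume *: "s \<in> S" "t \<in> S" "i < p" "j < p" "s \<otimes> y [^] i = t \<otimes> y [^] j"
    then have "i = j" using adjoin_unique(1) [OF S y *(1,2,5)] by (simp add: cong_def)
    then show "s = t \<and> i = j" using adjoin_unique(2) [OF S y *(1,2,5)] by simp
  qed
  have "adjoin S y = (\<lambda>(s, i). s \<otimes> y [^] i) ` (S \<times> {..<p})"
  proof
    show "adjoin S y \<subseteq> (\<lambda>(s, i). s \<otimes> y [^] i) ` (S \<times> {..<p})"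
    proof
      fix a assume "a \<in> adjoin S y"
      then obtain s i where a: "a = s \<otimes> y [^] (i::nat)" "s \<in> S" by (auto simp: adjoin_def)
      then show "a \<in> (\<lambda>(s, i). s \<otimes> y [^] i) ` (S \<times> {..<p})"
        using pow_mod_p [OF y(1), of i] prime_gt_0_nat [OF prime_p] by (intro image_eqI [of _ _ "(s, i mod p)"]) auto
    qed
  qed (auto simp: adjoin_def)
  with card_image [OF inj] show ?thesis by (simp add: card_cartesian_product)
qed

text \<open>The value at \<open>y\<close> can be prescribed freely:
  \<open>s \<otimes> y [^] i\<close> is sent to \<open>\<chi> s + t * int i\<close>, which is well
  defined modulo \<open>p\<close> because \<open>s\<close> is determined and \<open>i\<close> is
  determined modulo \<open>p\<close>.\<close>

lemma hom_mod_adjoin: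
  assumes S: "subgroup S G" and y: "y \<in> carrier G" "y \<notin> S" and \<chi>: "hom_mod p G S \<chi>"
  obtains \<chi>' where "hom_mod p G (adjoin S y) \<chi>'" "\<And>s. s \<in> S \<Longrightarrow> [\<chi>' s = \<chi> s] (mod int p)"
    "[\<chi>' y = t] (mod int p)"
proof -
  interpret S: subgroup S G by fact
  define P where "P x si \<longleftrightarrow> fst si \<in> S \<and> x = fst si \<otimes> y [^] (snd si :: nat)" for x si
  define \<chi>' where "\<chi>' x = (let si = SOME si. P x si in \<chi> (fst si) + t * int (snd si))" for x
  have \<chi>': "[\<chi>' (s \<otimes> y [^] i) = \<chi> s + t * int i] (mod int p)" if s: "s \<in> S" for s and i :: nat
  proof -
    have "P (s \<otimes> y [^] i) (s, i)" using s by (simp add: P_def)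
    from someI [of "P (s \<otimes> y [^] i)", OF this] obtain r j
      where rj: "r \<in> S" "s \<otimes> y [^] i = r \<otimes> y [^] j" "\<chi>' (s \<otimes> y [^] i) = \<chi> r + t * int j"
      unfolding P_def \<chi>'_def Let_def by blast
    have ij: "[i = j] (mod p)" using adjoin_unique(1) [OF S y s rj(1,2)] .
    have "y [^] i = y [^] j" using ij pow_mod_p [OF y(1), of i] pow_mod_p [OF y(1), of j] by (simp add: cong_def)
    then have "r = s" using rj s y by (simp add: S.mem_carrier)
    moreover have "[int i = int j] (mod int p)" using ij by (simp add: cong_int_iff)
    ultimately show ?thesis using rj(3) by (simp add: cong_add cong_mult cong_sym)
  qed
  show thesis
  proof
    show "hom_mod p G (adjoin S y) \<chi>'"
      unfolding hom_mod_def
    proof (intro ballI)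
      fix a b assume "a \<in> adjoin S y" "b \<in> adjoin S y"
      then obtain s i r j where a: "a = s \<otimes> y [^] (i::nat)" "s \<in> S" and b: "b = r \<otimes> y [^] (j::nat)" "r \<in> S"
        by (auto simp: adjoin_def)
      then have ab: "a \<otimes> b = (s \<otimes> r) \<otimes> y [^] (i + j)"
        using y by (simp add: nat_pow_mult [symmetric] m_ac)
      have "[\<chi>' (a \<otimes> b) = \<chi> (s \<otimes> r) + t * int (i + j)] (mod int p)"
        unfolding ab using a b by (intro \<chi>') simp
      also have "[\<chi> (s \<otimes> r) + t * int (i + j) = (\<chi> s + \<chi> r) + t * int (i + j)] (mod int p)"
        by (intro cong_add hom_mod_add [OF \<chi>] a b cong_refl)
      also have "(\<chi> s + \<chi> r) + t * int (i + j) = (\<chi> s + t * int i) + (\<chi> r + t * int j)"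
        by (simp add: algebra_simps)
      also have "[\<dots> = \<chi>' a + \<chi>' b] (mod int p)"
        unfolding a b by (intro cong_add cong_sym [OF \<chi>'] a b)
      finally show "[\<chi>' (a \<otimes> b) = \<chi>' a + \<chi>' b] (mod int p)" .
    qed
    show "[\<chi>' s = \<chi> s] (mod int p)" if "s \<in> S" for s
      using \<chi>' [OF that, of 0] that by (simp add: S.mem_carrier)
    have "[\<chi>' y = \<chi> \<one> + t] (mod int p)"
      using \<chi>' [of \<one> 1] y by simp
    also have "[\<chi> \<one> + t = 0 + t] (mod int p)"
      by (intro cong_add cong_refl hom_mod_one [OF \<chi>]) simp
    finally show "[\<chi>' y = t] (mod int p)" by simp
  qed
qed

lemma card_adjoin_less:
  assumes S: "subgroup S G" and y: "y \<in> carrier G" "y \<notin> S"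
  shows "card (carrier G) - card (adjoin S y) < card (carrier G) - card S"
proof -
  have "S \<subset> adjoin S y" using subset_adjoin [OF S y(1)] mem_adjoin [OF S y(1)] y by blast
  moreover have "adjoin S y \<subseteq> carrier G" by (rule subgroup.subset [OF subgroup_adjoin [OF S y(1)]])
  ultimately have "card S < card (adjoin S y)" "card (adjoin S y) \<le> card (carrier G)"
    using finite_carrier finite_subset by (metis psubset_card_mono, metis card_mono)
  then show ?thesis by linarith
qed

text \<open>Adjoining elements one at a time, with arbitrary values, reaches the whole carrier by
  finiteness.\<close>

lemma hom_mod_extend:
  assumes S: "subgroup S G" and \<chi>: "hom_mod p G S \<chi>"
  obtains \<chi>' where "hom_mod p G (carrier G) \<chi>'" "\<And>s. s \<in> S \<Longrightarrow> [\<chi>' s = \<chi> s] (mod int p)"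
  using S \<chi>
proof (induction "card (carrier G) - card S" arbitrary: S \<chi> thesis rule: less_induct)
  case less
  note S = less.prems(2)
  show ?case
  proof (cases "S = carrier G")
    case True
    with less.prems(3) show ?thesis by (intro less.prems(1) [of \<chi>]) simp_all
  next
    case False
    then obtain y where y: "y \<in> carrier G" "y \<notin> S" using subgroup.subset [OF S] by blast
    obtain \<chi>1 where 1: "hom_mod p G (adjoin S y) \<chi>1" "\<And>s. s \<in> S \<Longrightarrow> [\<chi>1 s = \<chi> s] (mod int p)"
      using hom_mod_adjoin [OF S y less.prems(3)] by metis
    obtain \<chi>2 where 2: "hom_mod p G (carrier G) \<chi>2" "\<And>s. s \<in> adjoin S y \<Longrightarrow> [\<chi>2 s = \<chi>1 s] (mod int p)"
      using less.hyps [OF card_adjoin_less [OF S y] _ subgroup_adjoin [OF S y(1)] 1(1)] by metis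
    show ?thesis
    proof (rule less.prems(1) [OF 2(1)])
      fix s assume s: "s \<in> S"
      then have "s \<in> adjoin S y" using subset_adjoin [OF S y(1)] by blast
      from cong_trans [OF 2(2) [OF this] 1(2) [OF s]] show "[\<chi>2 s = \<chi> s] (mod int p)" .
    qed
  qed
qed

text \<open>The zero character of \<open>S\<close> takes the value 1 at \<open>y\<close> after
  adjoining \<open>y\<close>, and then extends. Membership in a subgroup is tested by characters
  through this lemma.\<close>

lemma hom_mod_separate:
  assumes S: "subgroup S G" and y: "y \<in> carrier G" "y \<notin> S"
  obtains \<chi> where "hom_mod p G (carrier G) \<chi>" "\<And>s. s \<in> S \<Longrightarrow> [\<chi> s = 0] (mod int p)"
    "[\<chi> y = 1] (mod int p)"
proof -
  have "hom_mod p G S (\<lambda>_. 0)" by (simp add: hom_mod_def)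
  then obtain \<chi> where 1: "hom_mod p G (adjoin S y) \<chi>" "\<And>s. s \<in> S \<Longrightarrow> [\<chi> s = 0] (mod int p)"
    "[\<chi> y = 1] (mod int p)"
    using hom_mod_adjoin [OF S y] by metis
  obtain \<chi>' where 2: "hom_mod p G (carrier G) \<chi>'" "\<And>s. s \<in> adjoin S y \<Longrightarrow> [\<chi>' s = \<chi> s] (mod int p)"
    using hom_mod_extend [OF subgroup_adjoin [OF S y(1)] 1(1)] by metis
  show thesis
    using that [OF 2(1)] 1 2(2) subset_adjoin [OF S y(1)] mem_adjoin [OF S y(1)]
    by (meson cong_trans subsetD)
qed

text \<open>A basis \<open>x\<close> of the quotient by \<open>S\<close> with dual coordinates
  \<open>a\<close>, stated without the quotient: generation says that no proper subgroup contains
  \<open>S\<close> and all \<open>x i\<close>, and the cardinality fixes the dimension.\<close>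

definition basis_mod :: "'a set \<Rightarrow> nat \<Rightarrow> (nat \<Rightarrow> 'a) \<Rightarrow> (nat \<Rightarrow> 'a \<Rightarrow> int) \<Rightarrow> bool" where
  "basis_mod S k x a \<longleftrightarrow>
     (\<forall>i<k. x i \<in> carrier G \<and> hom_mod p G (carrier G) (a i) \<and>
        (\<forall>s\<in>S. [a i s = 0] (mod int p)) \<and> (\<forall>j<k. [a i (x j) = of_bool (i = j)] (mod int p))) \<and>
     (\<forall>T. subgroup T G \<longrightarrow> S \<subseteq> T \<longrightarrow> (\<forall>i<k. x i \<in> T) \<longrightarrow> T = carrier G) \<and>
     card (carrier G) = p ^ k * card S"

text \<open>A basis modulo the larger subgroup \<open>adjoin S y\<close> is prolonged by
  \<open>y\<close>, at which the old coordinates vanish because it lies in that subgroup.\<close>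

lemma exists_basis_mod:
  assumes S: "subgroup S G"
  shows "\<exists>k x a. basis_mod S k x a"
  using S
proof (induction "card (carrier G) - card S" arbitrary: S rule: less_induct)
  case less
  note S = less.prems
  show ?case
  proof (cases "S = carrier G")
    case True
    then have "basis_mod S 0 x a" for x a
      by (auto simp: basis_mod_def dest: subgroup.subset)
    then show ?thesis by blast
  next
    case False
    then obtain y where y: "y \<in> carrier G" "y \<notin> S" using subgroup.subset [OF S] by blast
    let ?S = "adjoin S y"
    obtain k x a where "basis_mod ?S k x a"
      using less.hyps [OF card_adjoin_less [OF S y] subgroup_adjoin [OF S y(1)]] by blast
    then have x: "\<And>i. i < k \<Longrightarrow> x i \<in> carrier G"
      and a: "\<And>i. i < k \<Longrightarrow> hom_mod p G (carrier G) (a i)"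
      and aS: "\<And>i s. i < k \<Longrightarrow> s \<in> ?S \<Longrightarrow> [a i s = 0] (mod int p)"
      and ax: "\<And>i j. i < k \<Longrightarrow> j < k \<Longrightarrow> [a i (x j) = of_bool (i = j)] (mod int p)"
      and gen: "\<And>T. subgroup T G \<Longrightarrow> ?S \<subseteq> T \<Longrightarrow> (\<And>i. i < k \<Longrightarrow> x i \<in> T) \<Longrightarrow> T = carrier G"
      and card: "card (carrier G) = p ^ k * card ?S"
      unfolding basis_mod_def by blast+
    obtain \<chi> where \<chi>: "hom_mod p G (carrier G) \<chi>" "\<And>s. s \<in> S \<Longrightarrow> [\<chi> s = 0] (mod int p)"
      "[\<chi> y = 1] (mod int p)"
      using hom_mod_separate [OF S y] by metis
    \<comment> \<open>The functional that separates \<open>y\<close> from \<open>S\<close>,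
      corrected by the old coordinates so that it vanishes at every old \<open>x i\<close>.\<close>
    define b where "b g = \<chi> g - (\<Sum>i<k. \<chi> (x i) * a i g)" for g
    have b_hom: "hom_mod p G (carrier G) b"
      unfolding hom_mod_def
    proof (intro ballI)
      fix g h assume g: "g \<in> carrier G" and h: "h \<in> carrier G"
      have "[b (g \<otimes> h) = (\<chi> g + \<chi> h) - (\<Sum>i<k. \<chi> (x i) * (a i g + a i h))] (mod int p)"
        unfolding b_def using a g h
        by (intro cong_diff cong_sum cong_mult cong_refl hom_mod_add [OF \<chi>(1)] hom_mod_add [OF a]) auto
      then show "[b (g \<otimes> h) = b g + b h] (mod int p)"
        by (simp add: b_def algebra_simps sum.distrib)
    qed
    have b_S: "[b s = \<chi> s] (mod int p)" if "s \<in> ?S" for s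
    proof -
      have "[b s = \<chi> s - (\<Sum>i<k. \<chi> (x i) * 0)] (mod int p)"
        unfolding b_def using that by (intro cong_diff cong_sum cong_mult cong_refl aS) auto
      then show ?thesis by simp
    qed
    have b_x: "[b (x j) = 0] (mod int p)" if "j < k" for j
    proof -
      have "[b (x j) = \<chi> (x j) - (\<Sum>i<k. \<chi> (x i) * of_bool (i = j))] (mod int p)"
        unfolding b_def using that by (intro cong_diff cong_sum cong_mult cong_refl ax) auto
      also have "(\<Sum>i<k. \<chi> (x i) * of_bool (i = j)) = \<chi> (x j)"
        using that sum.delta [of "{..<k}" j "\<lambda>i. \<chi> (x i)"] by (simp add: of_bool_def if_distrib cong: if_cong)
      finally show ?thesis by simp
    qed
    define x' where "x' = x(k := y)"
    define a' where "a' = a(k := b)"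
    have "basis_mod S (Suc k) x' a'"
      unfolding basis_mod_def
    proof (intro conjI allI impI ballI)
      fix i assume i: "i < Suc k"
      show "x' i \<in> carrier G" using i x y by (auto simp: x'_def less_Suc_eq)
      show "hom_mod p G (carrier G) (a' i)" using i a b_hom by (auto simp: a'_def less_Suc_eq)
      show "[a' i s = 0] (mod int p)" if s: "s \<in> S" for s
      proof (cases "i = k")
        case True
        have "s \<in> ?S" using s subset_adjoin [OF S y(1)] by blast
        from cong_trans [OF b_S [OF this] \<chi>(2) [OF s]] True show ?thesis by (simp add: a'_def)
      next
        case False
        with i aS s subset_adjoin [OF S y(1)] show ?thesis by (auto simp: a'_def)
      qed
      show "[a' i (x' j) = of_bool (i = j)] (mod int p)" if j: "j < Suc k" for j
      proof -
        have "[b y = 1] (mod int p)"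
          by (rule cong_trans [OF b_S [OF mem_adjoin [OF S y(1)]] \<chi>(3)])
        moreover have "[a i y = 0] (mod int p)" if "i < k" using aS [OF that mem_adjoin [OF S y(1)]] .
        ultimately show ?thesis using i j b_x [of j] ax [of i j]
          by (cases "i = k"; cases "j = k") (simp_all add: a'_def x'_def)
      qed
    next
      fix T assume T: "subgroup T G" "S \<subseteq> T" and "\<forall>i<Suc k. x' i \<in> T"
      then have "y \<in> T" "\<And>i. i < k \<Longrightarrow> x i \<in> T" by (auto simp: x'_def less_Suc_eq split: if_splits)
      with T show "T = carrier G" by (intro gen adjoin_subset)
    next
      show "card (carrier G) = p ^ Suc k * card S"
        using card card_adjoin [OF S y] by simp
    qed
    then show ?thesis by blast
  qed
qed

end

section \<open>Baer correspondence\<close>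

definition (in group) commutator :: "'a \<Rightarrow> 'a \<Rightarrow> 'a" where
  "commutator x y = x \<otimes> y \<otimes> inv x \<otimes> inv y"

locale class_two_group = group G for G (structure) +
  fixes p :: nat
  assumes prime_p: "Factorial_Ring.prime p" and odd_p: "odd p"
    and exponent_p: "x \<in> carrier G \<Longrightarrow> x [^] p = \<one>"
    and finite_carrier: "finite (carrier G)"
    and derived_central: "derived G (carrier G) \<subseteq> group_center G"
begin

abbreviation Z :: "'a set" where "Z \<equiv> group_center G"

lemma Z_carrier: "z \<in> Z \<Longrightarrow> z \<in> carrier G"
  by (simp add: group_center_def)

lemma Z_comm: "z \<in> Z \<Longrightarrow> x \<in> carrier G \<Longrightarrow> x \<otimes> z = z \<otimes> x"
  by (simp add: group_center_def)

lemma Z_left_comm: "z \<in> Z \<Longrightarrow> x \<in> carrier G \<Longrightarrow> y \<in> carrier G \<Longrightarrow> x \<otimes> (z \<otimes> y) = z \<otimes> (x \<otimes> y)"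
  by (metis Z_carrier Z_comm m_assoc)

lemma commutator_closed [simp]: "x \<in> carrier G \<Longrightarrow> y \<in> carrier G \<Longrightarrow> commutator x y \<in> carrier G"
  by (simp add: commutator_def)

lemma commutator_derived:
  assumes "x \<in> carrier G" "y \<in> carrier G"
  shows "commutator x y \<in> derived G (carrier G)"
  unfolding derived_def commutator_def using assms by (intro generate.incl) blast

lemma commutator_Z: "x \<in> carrier G \<Longrightarrow> y \<in> carrier G \<Longrightarrow> commutator x y \<in> Z"
  using commutator_derived derived_central by blast

lemma mult_eq_commutator:
  assumes "x \<in> carrier G" "y \<in> carrier G"
  shows "x \<otimes> y = commutator x y \<otimes> (y \<otimes> x)"
proof -
  have "inv y \<otimes> (y \<otimes> x) = x" using assms by (simp add: m_assoc [symmetric])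
  then show ?thesis using assms by (simp add: commutator_def m_assoc)
qed

lemma commutator_eq_one:
  "x \<in> carrier G \<Longrightarrow> y \<in> carrier G \<Longrightarrow> commutator x y = \<one> \<longleftrightarrow> x \<otimes> y = y \<otimes> x"
  unfolding commutator_def by (rule commutator_eq_one_iff)

lemma commutator_unique:
  assumes "x \<in> carrier G" "y \<in> carrier G" "w \<in> carrier G" "x \<otimes> y = w \<otimes> (y \<otimes> x)"
  shows "commutator x y = w"
  using assms mult_eq_commutator [OF assms(1,2)] by simp

text \<open>Moving \<open>z\<close> past \<open>x \<otimes> y\<close> costs two commutators; being
  central, they can be collected in front.\<close>

lemma commutator_mult_left:
  assumes [simp]: "x \<in> carrier G" "y \<in> carrier G" "z \<in> carrier G"
  shows "commutator (x \<otimes> y) z = commutator x z \<otimes> commutator y z"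
proof (rule commutator_unique)
  have "x \<otimes> y \<otimes> z = x \<otimes> (y \<otimes> z)" by (simp add: m_assoc)
  also have "\<dots> = x \<otimes> (commutator y z \<otimes> (z \<otimes> y))"
    by (subst mult_eq_commutator [of y z]) simp_all
  also have "\<dots> = commutator y z \<otimes> (x \<otimes> z \<otimes> y)"
    using Z_left_comm [OF commutator_Z [of y z], of x "z \<otimes> y"] by (simp add: m_assoc)
  also have "\<dots> = commutator y z \<otimes> (commutator x z \<otimes> (z \<otimes> x) \<otimes> y)"
    by (subst mult_eq_commutator [of x z]) simp_all
  also have "\<dots> = commutator x z \<otimes> commutator y z \<otimes> (z \<otimes> (x \<otimes> y))"
    using Z_comm [OF commutator_Z [of y z], of "commutator x z"]
    by (simp add: m_assoc [symmetric])
  finally show "x \<otimes> y \<otimes> z = commutator x z \<otimes> commutator y z \<otimes> (z \<otimes> (x \<otimes> y))" .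
qed simp_all

lemma commutator_swap:
  assumes [simp]: "x \<in> carrier G" "y \<in> carrier G"
  shows "commutator y x = inv (commutator x y)"
proof -
  have "inv (x \<otimes> y \<otimes> inv x \<otimes> inv y) = y \<otimes> x \<otimes> inv y \<otimes> inv x"
    by (simp add: inv_mult_group m_assoc)
  then show ?thesis by (simp add: commutator_def)
qed

lemma commutator_mult_right:
  assumes [simp]: "x \<in> carrier G" "y \<in> carrier G" "z \<in> carrier G"
  shows "commutator x (y \<otimes> z) = commutator x y \<otimes> commutator x z"
proof -
  have "commutator x (y \<otimes> z) = inv (commutator y x \<otimes> commutator z x)"
    by (subst commutator_swap) (simp_all add: commutator_mult_left)
  also have "\<dots> = commutator x z \<otimes> commutator x y"
    by (simp add: inv_mult_group commutator_swap [symmetric])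
  also have "\<dots> = commutator x y \<otimes> commutator x z"
    by (simp add: Z_comm commutator_Z)
  finally show ?thesis .
qed

lemma commutator_central:
  assumes "x \<in> carrier G" "z \<in> Z"
  shows "commutator x z = \<one>" "commutator z x = \<one>"
  using assms Z_carrier [OF assms(2)] Z_comm [OF assms(2,1)]
  by (metis commutator_eq_one)+

lemma commutator_self: "x \<in> carrier G \<Longrightarrow> commutator x x = \<one>"
  by (simp add: commutator_eq_one)

definition half_commutator :: "'a \<Rightarrow> 'a \<Rightarrow> 'a" where
  "half_commutator x y = commutator x y [^] ((p - 1) div 2)"

text \<open>As \<open>(p - 1) div 2\<close> is \<open>-1/2\<close> modulo \<open>p\<close>, this is the additive
  group of the Lie ring of \<open>G\<close>.\<close>
definition baer :: "('a, 'b) monoid_scheme" where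
  "baer = G\<lparr>monoid.mult := \<lambda>x y. x \<otimes> y \<otimes> half_commutator x y\<rparr>"

lemma baer_simps [simp]: "carrier baer = carrier G" "\<one>\<^bsub>baer\<^esub> = \<one>"
    "x \<otimes>\<^bsub>baer\<^esub> y = x \<otimes> y \<otimes> half_commutator x y"
  by (simp_all add: baer_def)

lemma half_commutator_Z: "x \<in> carrier G \<Longrightarrow> y \<in> carrier G \<Longrightarrow> half_commutator x y \<in> Z"
  unfolding half_commutator_def by (intro subgroup_pow_closed group_center_subgroup commutator_Z)

lemma half_commutator_closed [simp]:
  "x \<in> carrier G \<Longrightarrow> y \<in> carrier G \<Longrightarrow> half_commutator x y \<in> carrier G"
  by (simp add: half_commutator_def)

lemma half_commutator_mult:
  assumes "x \<in> carrier G" "y \<in> carrier G" "z \<in> carrier G"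
  shows "half_commutator (x \<otimes> y) z = half_commutator x z \<otimes> half_commutator y z"
    and "half_commutator x (y \<otimes> z) = half_commutator x y \<otimes> half_commutator x z"
  using assms by (simp_all add: half_commutator_def commutator_mult_left commutator_mult_right
    pow_mult_distrib Z_comm commutator_Z)

lemma half_commutator_central:
  "x \<in> carrier G \<Longrightarrow> z \<in> Z \<Longrightarrow> half_commutator x z = \<one>"
  "x \<in> carrier G \<Longrightarrow> z \<in> Z \<Longrightarrow> half_commutator z x = \<one>"
  by (simp_all add: half_commutator_def commutator_central)

text \<open>Since \<open>p = 1 + ?e + ?e\<close>, the power of the commutator with exponent
  \<open>1 + ?e\<close> is the inverse of the one with exponent \<open>?e\<close>. So the half
  commutator absorbs the commutator that swapping produces.\<close>

lemma baer_mult_commute: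
  assumes [simp]: "x \<in> carrier G" "y \<in> carrier G"
  shows "x \<otimes> y \<otimes> half_commutator x y = y \<otimes> x \<otimes> half_commutator y x"
proof -
  let ?c = "commutator x y" and ?e = "(p - 1) div 2"
  have "p = 1 + ?e + ?e" using odd_p by presburger
  then have "?c [^] (1 + ?e + ?e) = \<one>" using exponent_p [of ?c] by simp
  then have "(?c \<otimes> ?c [^] ?e) \<otimes> ?c [^] ?e = \<one>"
    by (simp only: nat_pow_mult [symmetric] commutator_closed assms nat_pow_eone)
  then have "?c \<otimes> ?c [^] ?e = inv (?c [^] ?e)"
    by (metis assms commutator_closed inv_equality inv_inv m_closed nat_pow_closed inv_closed)
  then have *: "?c \<otimes> half_commutator x y = half_commutator y x"
    by (simp add: half_commutator_def commutator_swap [of x y] nat_pow_inv)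
  have "x \<otimes> y \<otimes> half_commutator x y = ?c \<otimes> (y \<otimes> x) \<otimes> half_commutator x y"
    by (subst mult_eq_commutator) simp_all
  also have "\<dots> = (y \<otimes> x) \<otimes> (?c \<otimes> half_commutator x y)"
    using Z_comm [OF commutator_Z [of x y], of "y \<otimes> x"] by (simp add: m_assoc [symmetric])
  finally show ?thesis unfolding * .
qed

text \<open>Associativity of the modified product, once the half commutators have been expanded
  bilinearly into the central factors \<open>a\<close>, \<open>b\<close>, \<open>c\<close>.\<close>

lemma Z_rearrange:
  assumes Z: "a \<in> Z" "b \<in> Z" "c \<in> Z" and [simp]: "x \<in> carrier G" "y \<in> carrier G" "z \<in> carrier G"
  shows "x \<otimes> y \<otimes> a \<otimes> z \<otimes> (b \<otimes> c) = x \<otimes> (y \<otimes> z \<otimes> c) \<otimes> (a \<otimes> b)"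
proof -
  have [simp]: "a \<in> carrier G" "b \<in> carrier G" "c \<in> carrier G" using Z Z_carrier by blast+
  have "x \<otimes> y \<otimes> a \<otimes> z \<otimes> (b \<otimes> c) = x \<otimes> y \<otimes> (a \<otimes> z) \<otimes> (b \<otimes> c)" by (simp add: m_assoc)
  also have "a \<otimes> z = z \<otimes> a" using Z_comm [OF Z(1)] by simp
  also have "x \<otimes> y \<otimes> (z \<otimes> a) \<otimes> (b \<otimes> c) = x \<otimes> (y \<otimes> z) \<otimes> (a \<otimes> b \<otimes> c)" by (simp add: m_assoc)
  also have "a \<otimes> b \<otimes> c = c \<otimes> (a \<otimes> b)" using Z_comm [OF Z(3)] by simp
  also have "x \<otimes> (y \<otimes> z) \<otimes> (c \<otimes> (a \<otimes> b)) = x \<otimes> (y \<otimes> z \<otimes> c) \<otimes> (a \<otimes> b)" by (simp add: m_assoc)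
  finally show ?thesis .
qed

lemma comm_group_baer: "comm_group baer"
proof (rule comm_groupI)
  fix x y z assume "x \<in> carrier baer" "y \<in> carrier baer" "z \<in> carrier baer"
  then have [simp]: "x \<in> carrier G" "y \<in> carrier G" "z \<in> carrier G" by simp_all
  have hz: "half_commutator u v \<in> Z" if "u \<in> carrier G" "v \<in> carrier G" for u v
    using that by (rule half_commutator_Z)
  show "x \<otimes>\<^bsub>baer\<^esub> y \<otimes>\<^bsub>baer\<^esub> z = x \<otimes>\<^bsub>baer\<^esub> (y \<otimes>\<^bsub>baer\<^esub> z)"
    using half_commutator_central [OF _ hz] Z_rearrange [OF hz [of x y] hz [of x z] hz [of y z], of x y z]
    by (simp add: half_commutator_mult)
  show "x \<otimes>\<^bsub>baer\<^esub> y = y \<otimes>\<^bsub>baer\<^esub> x" by (simp add: baer_mult_commute)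
next
  fix x assume "x \<in> carrier baer"
  then have [simp]: "x \<in> carrier G" by simp
  have "commutator \<one> x = \<one>" by (simp add: commutator_eq_one)
  then show "\<one>\<^bsub>baer\<^esub> \<otimes>\<^bsub>baer\<^esub> x = x" by (simp add: half_commutator_def)
  have "commutator (inv x) x = \<one>" by (simp add: commutator_eq_one)
  then show "\<exists>y\<in>carrier baer. y \<otimes>\<^bsub>baer\<^esub> x = \<one>\<^bsub>baer\<^esub>"
    by (intro bexI [of _ "inv x"]) (simp_all add: half_commutator_def)
qed simp_all

text \<open>An element commutes with its powers, so the half commutators involved are trivial. In
  this way \<open>baer\<close> inherits the exponent \<open>p\<close>.\<close>

lemma baer_pow:
  assumes [simp]: "x \<in> carrier G"
  shows "x [^]\<^bsub>baer\<^esub> (k::nat) = x [^] k"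
proof (induction k)
  case (Suc k)
  have "x [^] k \<otimes> x = x \<otimes> x [^] k" by (simp flip: nat_pow_Suc2)
  then have "commutator (x [^] k) x = \<one>"
    using commutator_eq_one by simp
  with Suc show ?case by (simp add: half_commutator_def)
qed simp

sublocale baer: elementary_abelian baer p
proof -
  interpret B: comm_group baer by (rule comm_group_baer)
  show "elementary_abelian baer p"
    by unfold_locales (simp_all add: prime_p baer_pow exponent_p finite_carrier)
qed

lemma baer_subgroup:
  assumes H: "subgroup H G"
  shows "subgroup H baer"
proof -
  interpret H: subgroup H G by fact
  have hc: "half_commutator x y \<in> H" if "x \<in> H" "y \<in> H" for x y
    unfolding half_commutator_def commutator_def using that by (intro subgroup_pow_closed [OF H]) simp
  show ?thesis
  proof (rule baer.subgroupI)
    show "H \<subseteq> carrier baer" using H.subset by simp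
    show "H \<noteq> {}" using H.one_closed by blast
  next
    fix a assume a: "a \<in> H"
    then have [simp]: "a \<in> carrier G" by (rule H.mem_carrier)
    have "commutator (inv a) a = \<one>" by (simp add: commutator_eq_one)
    then have "inv a \<otimes>\<^bsub>baer\<^esub> a = \<one>\<^bsub>baer\<^esub>" by (simp add: half_commutator_def)
    then have "inv\<^bsub>baer\<^esub> a = inv a" by (intro baer.inv_equality) simp_all
    with a show "inv\<^bsub>baer\<^esub> a \<in> H" by simp
  qed (simp add: hc)
qed

lemma hom_mod_baer_Z:
  assumes "H \<subseteq> Z"
  shows "hom_mod p baer H \<chi> \<longleftrightarrow> hom_mod p G H \<chi>"
proof -
  have "x \<otimes> y \<otimes> half_commutator x y = x \<otimes> y" if "x \<in> H" "y \<in> H" for x y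
    using that assms Z_carrier by (simp add: half_commutator_central subset_iff)
  then show ?thesis by (simp add: hom_mod_def)
qed

text \<open>The class-two case of the Baker-Campbell-Hausdorff formula: in additive terms the
  product of \<open>G\<close> is x + y + [x,y]/2, and doubling avoids the fraction.\<close>

lemma hom_mod_baer_mult:
  assumes \<nu>: "hom_mod p baer (carrier G) \<nu>" and [simp]: "x \<in> carrier G" "y \<in> carrier G"
  shows "[2 * \<nu> (x \<otimes> y) = 2 * (\<nu> x + \<nu> y) + \<nu> (commutator x y)] (mod int p)"
proof -
  let ?h = "half_commutator x y"
  obtain e where e: "p = 2 * e + 1" using odd_p by (elim oddE)
  have "x \<otimes> y \<otimes>\<^bsub>baer\<^esub> ?h = x \<otimes>\<^bsub>baer\<^esub> y"
    by (simp add: half_commutator_central half_commutator_Z)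
  then have "[\<nu> (x \<otimes>\<^bsub>baer\<^esub> y) = \<nu> (x \<otimes> y) + \<nu> ?h] (mod int p)"
    using hom_mod_add [OF \<nu>, of "x \<otimes> y" ?h] by simp
  moreover have "[\<nu> (x \<otimes>\<^bsub>baer\<^esub> y) = \<nu> x + \<nu> y] (mod int p)"
    using hom_mod_add [OF \<nu>] by simp
  ultimately have 1: "[\<nu> (x \<otimes> y) + \<nu> ?h = \<nu> x + \<nu> y] (mod int p)"
    by (meson cong_sym cong_trans)
  have h: "[\<nu> ?h = int e * \<nu> (commutator x y)] (mod int p)"
  proof -
    have "half_commutator x y = commutator x y [^]\<^bsub>baer\<^esub> e"
      by (simp add: half_commutator_def baer_pow) (simp add: e)
    then show ?thesis
      using baer.hom_mod_pow [OF \<nu>, of "commutator x y" e] baer.subgroup_self by simp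
  qed
  have "[2 * (\<nu> x + \<nu> y) + \<nu> (commutator x y) =
      2 * (\<nu> (x \<otimes> y) + int e * \<nu> (commutator x y)) + \<nu> (commutator x y)] (mod int p)"
    by (intro cong_add cong_mult cong_refl cong_trans [OF cong_sym [OF 1]] h)
  also have "2 * (\<nu> (x \<otimes> y) + int e * \<nu> (commutator x y)) + \<nu> (commutator x y) =
      2 * \<nu> (x \<otimes> y) + int p * \<nu> (commutator x y)"
    by (simp add: e algebra_simps)
  also have "[2 * \<nu> (x \<otimes> y) + int p * \<nu> (commutator x y) = 2 * \<nu> (x \<otimes> y)] (mod int p)"
    by (simp add: cong_iff_dvd_diff)
  finally show ?thesis by (rule cong_sym)
qed

text \<open>The centre is a subgroup of the abelian group \<open>baer\<close>, where \<chi> extends.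
  Taking \<nu> to be twice the extension turns the defect of additivity on \<open>G\<close> from
  half the commutator value into the full one.\<close>

lemma hom_mod_Z_extend:
  assumes \<chi>: "hom_mod p G Z \<chi>"
  obtains \<nu> where "\<And>z. z \<in> Z \<Longrightarrow> [\<nu> z = 2 * \<chi> z] (mod int p)"
    "\<And>x y. x \<in> carrier G \<Longrightarrow> y \<in> carrier G \<Longrightarrow>
      [\<nu> (x \<otimes> y) = \<nu> x + \<nu> y + \<chi> (commutator x y)] (mod int p)"
proof -
  obtain \<chi>' where 1: "hom_mod p baer (carrier G) \<chi>'" "\<And>s. s \<in> Z \<Longrightarrow> [\<chi>' s = \<chi> s] (mod int p)"
    using baer.hom_mod_extend [OF baer_subgroup [OF group_center_subgroup], of \<chi>] \<chi>
    by (auto simp: hom_mod_baer_Z)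
  show thesis
  proof (rule that [of "\<lambda>x. 2 * \<chi>' x"])
    show "[2 * \<chi>' z = 2 * \<chi> z] (mod int p)" if "z \<in> Z" for z
      by (intro cong_mult cong_refl 1 that)
    fix x y assume "x \<in> carrier G" "y \<in> carrier G"
    from cong_trans [OF hom_mod_baer_mult [OF 1(1) this]
      cong_add [OF cong_refl 1(2) [OF commutator_Z [OF this]]]]
    show "[2 * \<chi>' (x \<otimes> y) = 2 * \<chi>' x + 2 * \<chi>' y + \<chi> (commutator x y)] (mod int p)"
      by (simp add: algebra_simps)
  qed
qed

end

section \<open>A cocycle on a group of class two\<close>

lemma (in group) subgroup_hom_mod_kernel:
  assumes \<chi>: "hom_mod p G (carrier G) \<chi>"
  shows "subgroup {g \<in> carrier G. [\<chi> g = 0] (mod int p)} G"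
proof (rule subgroupI)
  show "{g \<in> carrier G. [\<chi> g = 0] (mod int p)} \<noteq> {}"
    using hom_mod_one [OF \<chi>] by auto
next
  fix g assume "g \<in> {g \<in> carrier G. [\<chi> g = 0] (mod int p)}"
  then have g: "g \<in> carrier G" "[\<chi> g = 0] (mod int p)" by auto
  have "[\<chi> (inv g) + \<chi> g = 0] (mod int p)"
    using cong_trans [OF cong_sym [OF hom_mod_add [OF \<chi>, of "inv g" g]], of 0] hom_mod_one [OF \<chi>] g by simp
  with g(2) have "[\<chi> (inv g) + \<chi> g - \<chi> g = 0 - 0] (mod int p)" by (intro cong_diff)
  with g show "inv g \<in> {g \<in> carrier G. [\<chi> g = 0] (mod int p)}" by simp
next
  fix g h assume "g \<in> {g \<in> carrier G. [\<chi> g = 0] (mod int p)}" "h \<in> {g \<in> carrier G. [\<chi> g = 0] (mod int p)}"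
  then show "g \<otimes> h \<in> {g \<in> carrier G. [\<chi> g = 0] (mod int p)}"
    using hom_mod_add [OF \<chi>, of g h] cong_add [of "\<chi> g" 0 "int p" "\<chi> h" 0]
    by (auto intro: cong_trans)
qed auto

definition trilinear :: "nat \<Rightarrow> (nat \<Rightarrow> nat \<Rightarrow> nat \<Rightarrow> int) \<Rightarrow>
    (nat \<Rightarrow> int) \<Rightarrow> (nat \<Rightarrow> int) \<Rightarrow> (nat \<Rightarrow> int) \<Rightarrow> int" where
  "trilinear n S a b d = (\<Sum>i<n. \<Sum>j<n. \<Sum>k<n. S i j k * a i * b j * d k)"

lemma trilinear_add:
  "trilinear n S (\<lambda>i. a i + a' i) b d = trilinear n S a b d + trilinear n S a' b d"
  "trilinear n S a (\<lambda>i. b i + b' i) d = trilinear n S a b d + trilinear n S a b' d"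
  "trilinear n S a b (\<lambda>i. d i + d' i) = trilinear n S a b d + trilinear n S a b d'"
  by (simp_all add: trilinear_def algebra_simps sum.distrib)

lemma trilinear_zero:
  "trilinear n S (\<lambda>_. 0) b d = 0" "trilinear n S a (\<lambda>_. 0) d = 0" "trilinear n S a b (\<lambda>_. 0) = 0"
  by (simp_all add: trilinear_def)

lemma trilinear_sym:
  assumes "\<And>i j k. S i j k = S i k j"
  shows "trilinear n S a b d = trilinear n S a d b"
proof -
  have "trilinear n S a b d = (\<Sum>i<n. \<Sum>k<n. \<Sum>j<n. S i j k * a i * b j * d k)"
    unfolding trilinear_def by (intro sum.cong refl sum.swap)
  also have "\<dots> = trilinear n S a d b"
    unfolding trilinear_def using assms by (intro sum.cong refl) (metis mult.assoc mult.commute)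
  finally show ?thesis .
qed

lemma trilinear_cong:
  assumes "\<And>i. i < n \<Longrightarrow> [a i = a' i] (mod m)" "\<And>i. i < n \<Longrightarrow> [b i = b' i] (mod m)"
    "\<And>i. i < n \<Longrightarrow> [d i = d' i] (mod m)"
  shows "[trilinear n S a b d = trilinear n S a' b' d'] (mod m)"
  unfolding trilinear_def using assms by (intro cong_sum cong_mult cong_refl) auto

locale class_two_basis = class_two_group +
  fixes n :: nat and x :: "nat \<Rightarrow> 'a" and a :: "nat \<Rightarrow> 'a \<Rightarrow> int"
  assumes x_closed [simp]: "i < n \<Longrightarrow> x i \<in> carrier G"
    and a_hom: "i < n \<Longrightarrow> hom_mod p G (carrier G) (a i)"
    and a_Z: "i < n \<Longrightarrow> z \<in> Z \<Longrightarrow> [a i z = 0] (mod int p)"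
    and a_x: "i < n \<Longrightarrow> j < n \<Longrightarrow> [a i (x j) = of_bool (i = j)] (mod int p)"
    and basis_generates: "subgroup T G \<Longrightarrow> Z \<subseteq> T \<Longrightarrow> (\<And>i. i < n \<Longrightarrow> x i \<in> T) \<Longrightarrow> T = carrier G"

text \<open>The basis is taken in \<open>baer\<close>. Its coordinates kill the centre, so the
  commutator defect disappears and, 2 being invertible modulo \<open>p\<close>, they are additive on
  \<open>G\<close> as well. A subgroup of \<open>G\<close> is also one of \<open>baer\<close>, so
  generation carries over.\<close>

lemma (in class_two_group) exists_class_two_basis:
  "\<exists>n x a. class_two_basis G p n x a \<and> card (carrier G) = p ^ n * card Z"
proof -
  obtain n x a where "baer.basis_mod Z n x a"
    using baer.exists_basis_mod [OF baer_subgroup [OF group_center_subgroup]] by blast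
  then have x: "\<And>i. i < n \<Longrightarrow> x i \<in> carrier G"
    and a: "\<And>i. i < n \<Longrightarrow> hom_mod p baer (carrier G) (a i)"
    and aZ: "\<And>i z. i < n \<Longrightarrow> z \<in> Z \<Longrightarrow> [a i z = 0] (mod int p)"
    and ax: "\<And>i j. i < n \<Longrightarrow> j < n \<Longrightarrow> [a i (x j) = of_bool (i = j)] (mod int p)"
    and gen: "\<And>T. subgroup T baer \<Longrightarrow> Z \<subseteq> T \<Longrightarrow> (\<And>i. i < n \<Longrightarrow> x i \<in> T) \<Longrightarrow> T = carrier G"
    and card: "card (carrier G) = p ^ n * card Z"
    unfolding baer.basis_mod_def by auto
  have "hom_mod p G (carrier G) (a i)" if i: "i < n" for i
    unfolding hom_mod_def
  proof (intro ballI)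
    fix g h assume g: "g \<in> carrier G" "h \<in> carrier G"
    have "[2 * (a i g + a i h) + a i (commutator g h) = 2 * (a i g + a i h) + 0] (mod int p)"
      by (intro cong_add cong_refl aZ i commutator_Z g)
    from cong_trans [OF hom_mod_baer_mult [OF a [OF i] g] this]
    have "[2 * a i (g \<otimes> h) = 2 * (a i g + a i h)] (mod int p)" by simp
    then show "[a i (g \<otimes> h) = a i g + a i h] (mod int p)"
      using odd_p by (subst (asm) cong_mult_lcancel) (simp_all add: coprime_int_iff [of 2 p, simplified])
  qed
  then have "class_two_basis G p n x a"
    by (intro class_two_basis.intro class_two_group_axioms class_two_basis_axioms.intro x aZ ax
      gen [OF baer_subgroup])
  with card show ?thesis by blast
qed

context class_two_basis
begin

text \<open>The difference of the two sides is a character whose kernel contains the centre and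
  every \<open>x j\<close>, hence everything.\<close>

lemma hom_mod_expand:
  assumes \<chi>: "hom_mod p G (carrier G) \<chi>" and \<chi>Z: "\<And>z. z \<in> Z \<Longrightarrow> [\<chi> z = 0] (mod int p)"
    and g: "g \<in> carrier G"
  shows "[\<chi> g = (\<Sum>i<n. a i g * \<chi> (x i))] (mod int p)"
proof -
  define \<psi> where "\<psi> g = \<chi> g - (\<Sum>i<n. a i g * \<chi> (x i))" for g
  have \<psi>: "hom_mod p G (carrier G) \<psi>"
    unfolding hom_mod_def
  proof (intro ballI)
    fix g h assume g: "g \<in> carrier G" and h: "h \<in> carrier G"
    have "[\<psi> (g \<otimes> h) = (\<chi> g + \<chi> h) - (\<Sum>i<n. (a i g + a i h) * \<chi> (x i))] (mod int p)"
      unfolding \<psi>_def using g h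
      by (intro cong_diff cong_sum cong_mult cong_refl hom_mod_add [OF \<chi>] hom_mod_add [OF a_hom]) auto
    then show "[\<psi> (g \<otimes> h) = \<psi> g + \<psi> h] (mod int p)"
      by (simp add: \<psi>_def algebra_simps sum.distrib)
  qed
  have "{g \<in> carrier G. [\<psi> g = 0] (mod int p)} = carrier G"
  proof (rule basis_generates [OF subgroup_hom_mod_kernel [OF \<psi>]])
    show "Z \<subseteq> {g \<in> carrier G. [\<psi> g = 0] (mod int p)}"
    proof
      fix z assume z: "z \<in> Z"
      have "[\<psi> z = 0 - (\<Sum>i<n. 0 * \<chi> (x i))] (mod int p)"
        unfolding \<psi>_def using z by (intro cong_diff cong_sum cong_mult cong_refl \<chi>Z a_Z) auto
      with z show "z \<in> {g \<in> carrier G. [\<psi> g = 0] (mod int p)}" by (simp add: Z_carrier)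
    qed
  next
    fix j assume j: "j < n"
    have "[\<psi> (x j) = \<chi> (x j) - (\<Sum>i<n. of_bool (i = j) * \<chi> (x i))] (mod int p)"
      unfolding \<psi>_def using j by (intro cong_diff cong_sum cong_mult cong_refl a_x) auto
    also have "(\<Sum>i<n. of_bool (i = j) * \<chi> (x i)) = \<chi> (x j)"
      using j by (simp add: of_bool_def if_distrib [of "\<lambda>c. c * _"] cong: if_cong)
    finally show "x j \<in> {g \<in> carrier G. [\<psi> g = 0] (mod int p)}" using j by simp
  qed
  with g have "[\<psi> g = 0] (mod int p)" by blast
  then show ?thesis by (simp add: \<psi>_def cong_diff_iff_cong_0)
qed

lemma hom_mod_commutator:
  assumes \<chi>: "hom_mod p G Z \<chi>" and [simp]: "g \<in> carrier G" "h \<in> carrier G"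
  shows "[\<chi> (commutator g h) =
    (\<Sum>i<n. \<Sum>j<n. a i g * a j h * \<chi> (commutator (x i) (x j)))] (mod int p)"
proof -
  have \<chi>1: "[\<chi> \<one> = 0] (mod int p)"
    using hom_mod_one [OF \<chi>] subgroup.one_closed [OF group_center_subgroup] by simp
  have l: "hom_mod p G (carrier G) (\<lambda>u. \<chi> (commutator u v))"
    and r: "hom_mod p G (carrier G) (\<lambda>u. \<chi> (commutator v u))" if "v \<in> carrier G" for v
    using that by (simp_all add: hom_mod_def commutator_mult_left commutator_mult_right
      hom_mod_add [OF \<chi>] commutator_Z)
  have "[\<chi> (commutator g h) = (\<Sum>i<n. a i g * \<chi> (commutator (x i) h))] (mod int p)"
    by (rule hom_mod_expand [OF l]) (simp_all add: commutator_central \<chi>1)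
  also have "[(\<Sum>i<n. a i g * \<chi> (commutator (x i) h)) =
      (\<Sum>i<n. a i g * (\<Sum>j<n. a j h * \<chi> (commutator (x i) (x j))))] (mod int p)"
    by (intro cong_sum cong_mult cong_refl hom_mod_expand [OF r])
      (simp_all add: commutator_central \<chi>1)
  finally show ?thesis by (simp add: sum_distrib_left mult.assoc)
qed

text \<open>Up to a factor \<open>2\<close>, the coboundary of the bilinear part of the cocycle is
  \<open>(S(u,v,w) - S(v,u,w)) / 2\<close>. This is a sum of a form symmetric in \<open>v, w\<close> and a form symmetric in
  \<open>u, v\<close>, each of which is a coboundary without a division by \<open>3\<close>, so \<open>p = 3\<close> is no exception.\<close>
lemma exists_cocycle:
  assumes sym: "\<And>i j k. S i j k = S i k j"
    and \<chi>: "\<And>k. k < n \<Longrightarrow> hom_mod p G Z (\<chi> k)"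
    and \<chi>S: "\<And>i j k. i < n \<Longrightarrow> j < n \<Longrightarrow> k < n \<Longrightarrow>
      [\<chi> k (commutator (x i) (x j)) = S i j k - S j i k] (mod int p)"
  obtains c where "two_cocycle p G c"
    "\<And>z h. z \<in> Z \<Longrightarrow> h \<in> carrier G \<Longrightarrow> [c z h = 2 * (\<Sum>k<n. \<chi> k z * a k h)] (mod int p)"
    "\<And>z h. z \<in> Z \<Longrightarrow> h \<in> carrier G \<Longrightarrow> [c h z = 0] (mod int p)"
proof -
  have "\<exists>\<nu>. (\<forall>z\<in>Z. [\<nu> z = 2 * \<chi> k z] (mod int p)) \<and> (\<forall>g\<in>carrier G. \<forall>h\<in>carrier G.
      [\<nu> (g \<otimes> h) = \<nu> g + \<nu> h + \<chi> k (commutator g h)] (mod int p))" if k: "k < n" for k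
    by (rule hom_mod_Z_extend [OF \<chi> [OF k]]) blast
  then obtain \<nu> where \<nu>Z: "\<And>k z. k < n \<Longrightarrow> z \<in> Z \<Longrightarrow> [\<nu> k z = 2 * \<chi> k z] (mod int p)"
    and \<nu>: "\<And>k g h. k < n \<Longrightarrow> g \<in> carrier G \<Longrightarrow> h \<in> carrier G \<Longrightarrow>
      [\<nu> k (g \<otimes> h) = \<nu> k g + \<nu> k h + \<chi> k (commutator g h)] (mod int p)"
    by metis
  let ?T = "trilinear n S"
  define A where "A g = (\<lambda>i. a i g)" for g
  \<comment> \<open>Write T(g,h,u) for \<open>?T (A g) (A h) (A u)\<close>. In the cocycle identity
    at \<open>g\<close>, \<open>h\<close>, \<open>u\<close> the first sum is off by T(g,h,u) -
    T(h,g,u), through the defect of \<nu> and the equations between \<chi> and \<open>S\<close>;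
    T(g,h,h) is off by -2 T(g,h,u), through the symmetry of \<open>S\<close>; T(g,g,h) is off by
    T(g,h,u) + T(h,g,u). These add up to zero.\<close>
  define c where "c g h = (\<Sum>k<n. \<nu> k g * a k h) + ?T (A g) (A h) (A h) + ?T (A g) (A g) (A h)" for g h
  have A_mult: "[A (g \<otimes> h) i = A g i + A h i] (mod int p)"
    if "i < n" "g \<in> carrier G" "h \<in> carrier G" for g h i
    unfolding A_def using hom_mod_add [OF a_hom] that by blast
  have A_Z: "[A z i = 0] (mod int p)" if "i < n" "z \<in> Z" for z i
    unfolding A_def using a_Z that by blast
  show thesis
  proof (rule that [of c])
    show "two_cocycle p G c"
      unfolding two_cocycle_def
    proof (intro ballI)
      fix g h u assume [simp]: "g \<in> carrier G" "h \<in> carrier G" "u \<in> carrier G"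
      have "[(\<Sum>k<n. \<chi> k (commutator g h) * a k u) =
          (\<Sum>k<n. (\<Sum>i<n. \<Sum>j<n. a i g * a j h * (S i j k - S j i k)) * a k u)] (mod int p)"
        by (intro cong_sum cong_mult cong_refl cong_trans [OF hom_mod_commutator [OF \<chi>]] \<chi>S) auto
      also have "(\<Sum>k<n. (\<Sum>i<n. \<Sum>j<n. a i g * a j h * (S i j k - S j i k)) * a k u) =
          (\<Sum>k<n. \<Sum>i<n. \<Sum>j<n. S i j k * a i g * a j h * a k u) -
          (\<Sum>k<n. \<Sum>i<n. \<Sum>j<n. S j i k * a j h * a i g * a k u)"
        by (simp only: sum_distrib_right sum_subtractf [symmetric])
          (intro sum.cong refl, simp add: algebra_simps)
      also have "(\<Sum>k<n. \<Sum>i<n. \<Sum>j<n. S i j k * a i g * a j h * a k u) = ?T (A g) (A h) (A u)"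
        unfolding trilinear_def A_def
        by (subst sum.swap) (intro sum.cong refl sum.swap)
      also have "(\<Sum>k<n. \<Sum>i<n. \<Sum>j<n. S j i k * a j h * a i g * a k u) = ?T (A h) (A g) (A u)"
      proof -
        have "(\<Sum>k<n. \<Sum>i<n. \<Sum>j<n. S j i k * a j h * a i g * a k u) =
            (\<Sum>k<n. \<Sum>j<n. \<Sum>i<n. S j i k * a j h * a i g * a k u)"
          by (intro sum.cong refl sum.swap)
        also have "\<dots> = ?T (A h) (A g) (A u)"
          unfolding trilinear_def A_def by (subst sum.swap) (intro sum.cong refl sum.swap)
        finally show ?thesis .
      qed
      finally have comm: "[(\<Sum>k<n. \<chi> k (commutator g h) * a k u) =
          ?T (A g) (A h) (A u) - ?T (A h) (A g) (A u)] (mod int p)" .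
      \<comment> \<open>The left-hand side without the commutator values.\<close>
      let ?W = "c g h + ((\<Sum>k<n. (\<nu> k g + \<nu> k h) * a k u) +
          ?T (\<lambda>i. A g i + A h i) (A u) (A u) +
          ?T (\<lambda>i. A g i + A h i) (\<lambda>i. A g i + A h i) (A u))"
      have "[c g h + c (g \<otimes> h) u = c g h +
          ((\<Sum>k<n. (\<nu> k g + \<nu> k h + \<chi> k (commutator g h)) * a k u) +
          ?T (\<lambda>i. A g i + A h i) (A u) (A u) +
          ?T (\<lambda>i. A g i + A h i) (\<lambda>i. A g i + A h i) (A u))] (mod int p)"
        unfolding c_def
        by (intro cong_add cong_sum cong_mult cong_refl trilinear_cong A_mult \<nu>) auto
      also have "c g h + ((\<Sum>k<n. (\<nu> k g + \<nu> k h + \<chi> k (commutator g h)) * a k u) +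
          ?T (\<lambda>i. A g i + A h i) (A u) (A u) +
          ?T (\<lambda>i. A g i + A h i) (\<lambda>i. A g i + A h i) (A u)) =
          (\<Sum>k<n. \<chi> k (commutator g h) * a k u) + ?W"
        by (simp add: algebra_simps sum.distrib)
      also have "[\<dots> = (?T (A g) (A h) (A u) - ?T (A h) (A g) (A u)) + ?W] (mod int p)"
        by (intro cong_add comm cong_refl)
      also have "(?T (A g) (A h) (A u) - ?T (A h) (A g) (A u)) + ?W = c h u + ((\<Sum>k<n. \<nu> k g * (a k h + a k u)) +
          ?T (A g) (\<lambda>i. A h i + A u i) (\<lambda>i. A h i + A u i) + ?T (A g) (A g) (\<lambda>i. A h i + A u i))"
        using trilinear_sym [where S = S and n = n and a = "A g" and b = "A h" and d = "A u", OF sym]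
        by (simp add: c_def trilinear_add algebra_simps sum.distrib)
      also have "[\<dots> = c h u + c g (h \<otimes> u)] (mod int p)"
        unfolding c_def
        by (intro cong_add cong_sum cong_mult cong_refl trilinear_cong cong_sym [OF A_mult]
            cong_sym [OF hom_mod_add [OF a_hom]]) auto
      finally show "[c g h + c (g \<otimes> h) u = c h u + c g (h \<otimes> u)] (mod int p)" .
    qed
    show "[c z h = 2 * (\<Sum>k<n. \<chi> k z * a k h)] (mod int p)" if z: "z \<in> Z" and h: "h \<in> carrier G" for z h
    proof -
      have "[c z h = (\<Sum>k<n. 2 * \<chi> k z * a k h) + ?T (\<lambda>_. 0) (A h) (A h) + ?T (\<lambda>_. 0) (\<lambda>_. 0) (A h)] (mod int p)"
        unfolding c_def using z h
        by (intro cong_add cong_sum cong_mult cong_refl trilinear_cong A_Z \<nu>Z) auto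
      then show ?thesis by (simp add: trilinear_zero sum_distrib_left mult.assoc)
    qed
    show "[c h z = 0] (mod int p)" if z: "z \<in> Z" and h: "h \<in> carrier G" for z h
    proof -
      have "[c h z = (\<Sum>k<n. \<nu> k h * 0) + ?T (A h) (\<lambda>_. 0) (\<lambda>_. 0) + ?T (A h) (A h) (\<lambda>_. 0)] (mod int p)"
        unfolding c_def using z h
        by (intro cong_add cong_sum cong_mult cong_refl trilinear_cong A_Z a_Z) auto
      then show ?thesis by (simp add: trilinear_zero)
    qed
  qed
qed

end

section \<open>Duality and leading terms\<close>

text \<open>Linear duality, by eliminating one functional \<open>r i\<close> at a time: if
  \<open>r i\<close> is nonzero at some \<phi>0 in the common kernel of the others, a multiple of
  \<open>r i\<close> is subtracted from \<open>w\<close> to make it vanish at \<phi>0. The operation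
  \<open>comb \<phi> t \<psi>\<close> plays the role of \<phi> + t \<psi>, so that \<open>F\<close>
  can later consist of pairs of characters and tensors.\<close>

lemma common_kernel_combination:
  fixes r :: "'i \<Rightarrow> 'f \<Rightarrow> int" and w :: "'f \<Rightarrow> int" and comb :: "'f \<Rightarrow> int \<Rightarrow> 'f \<Rightarrow> 'f"
  assumes p: "Factorial_Ring.prime (p::nat)" and I: "finite I"
    and closed: "\<And>\<phi> \<psi> t. \<phi> \<in> F \<Longrightarrow> \<psi> \<in> F \<Longrightarrow> comb \<phi> t \<psi> \<in> F"
    and r: "\<And>i \<phi> \<psi> t. i \<in> I \<Longrightarrow> \<phi> \<in> F \<Longrightarrow> \<psi> \<in> F \<Longrightarrow> [r i (comb \<phi> t \<psi>) = r i \<phi> + t * r i \<psi>] (mod int p)"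
    and w: "\<And>\<phi> \<psi> t. \<phi> \<in> F \<Longrightarrow> \<psi> \<in> F \<Longrightarrow> [w (comb \<phi> t \<psi>) = w \<phi> + t * w \<psi>] (mod int p)"
    and ker: "\<And>\<phi>. \<phi> \<in> F \<Longrightarrow> (\<And>i. i \<in> I \<Longrightarrow> [r i \<phi> = 0] (mod int p)) \<Longrightarrow> [w \<phi> = 0] (mod int p)"
  shows "\<exists>\<omega>. \<forall>\<phi>\<in>F. [w \<phi> = (\<Sum>i\<in>I. \<omega> i * r i \<phi>)] (mod int p)"
  using I r w ker
proof (induction I arbitrary: w rule: finite_induct)
  case empty
  then show ?case by simp
next
  case (insert i I)
  note r = insert.prems(1) and w = insert.prems(2) and ker = insert.prems(3)
  show ?case
  proof (cases "\<exists>\<phi>\<in>F. (\<forall>j\<in>I. [r j \<phi> = 0] (mod int p)) \<and> \<not> [r i \<phi> = 0] (mod int p)")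
    case False
    then have "\<exists>\<omega>. \<forall>\<phi>\<in>F. [w \<phi> = (\<Sum>j\<in>I. \<omega> j * r j \<phi>)] (mod int p)"
      by (intro insert.IH r w ker) auto
    then obtain \<omega> where \<omega>: "\<And>\<phi>. \<phi> \<in> F \<Longrightarrow> [w \<phi> = (\<Sum>j\<in>I. \<omega> j * r j \<phi>)] (mod int p)" by blast
    have "(\<Sum>j\<in>I. (\<omega>(i := 0)) j * r j \<phi>) = (\<Sum>j\<in>I. \<omega> j * r j \<phi>)" for \<phi>
      using insert.hyps by (intro sum.cong) auto
    then show ?thesis
      using \<omega> insert.hyps by (intro exI [of _ "\<omega>(i := 0)"]) simp
  next
    case True
    then obtain \<phi>0 where \<phi>0: "\<phi>0 \<in> F" "\<And>j. j \<in> I \<Longrightarrow> [r j \<phi>0 = 0] (mod int p)"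
      and ri: "\<not> [r i \<phi>0 = 0] (mod int p)" by blast
    have "coprime (r i \<phi>0) (int p)"
      using ri p by (metis cong_0_iff coprime_commute prime_imp_coprime prime_nat_int_transfer)
    then obtain u where u: "[r i \<phi>0 * u = 1] (mod int p)"
      using cong_solve_coprime_int by blast
    define t where "t = u * w \<phi>0"
    have "\<exists>\<omega>. \<forall>\<phi>\<in>F. [w \<phi> - t * r i \<phi> = (\<Sum>j\<in>I. \<omega> j * r j \<phi>)] (mod int p)"
    proof (rule insert.IH)
      show "[w (comb \<phi> s \<psi>) - t * r i (comb \<phi> s \<psi>) = (w \<phi> - t * r i \<phi>) + s * (w \<psi> - t * r i \<psi>)] (mod int p)"
        if "\<phi> \<in> F" "\<psi> \<in> F" for \<phi> \<psi> s
      proof -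
        have "[w (comb \<phi> s \<psi>) - t * r i (comb \<phi> s \<psi>) =
            (w \<phi> + s * w \<psi>) - t * (r i \<phi> + s * r i \<psi>)] (mod int p)"
          using that by (intro cong_diff cong_mult cong_refl w r) auto
        then show ?thesis by (simp add: algebra_simps)
      qed
      show "[w \<phi> - t * r i \<phi> = 0] (mod int p)"
        if \<phi>: "\<phi> \<in> F" and z: "\<And>j. j \<in> I \<Longrightarrow> [r j \<phi> = 0] (mod int p)" for \<phi>
      proof -
        \<comment> \<open>Moves \<phi> along \<phi>0 into the kernel of \<open>r i\<close> without
          leaving the kernels of the other functionals.\<close>
        let ?s = "- (r i \<phi> * u)"
        have "[w (comb \<phi> ?s \<phi>0) = 0] (mod int p)"
        proof (rule ker [OF closed [OF \<phi> \<phi>0(1)]])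
          fix j assume j: "j \<in> insert i I"
          have 1: "[r j (comb \<phi> ?s \<phi>0) = r j \<phi> + ?s * r j \<phi>0] (mod int p)"
            by (rule r [OF j \<phi> \<phi>0(1)])
          show "[r j (comb \<phi> ?s \<phi>0) = 0] (mod int p)"
          proof (cases "j = i")
            case True
            have "[r i \<phi> - r i \<phi> * (r i \<phi>0 * u) = r i \<phi> - r i \<phi> * 1] (mod int p)"
              by (intro cong_diff cong_mult cong_refl u)
            with 1 True show ?thesis by (auto simp: algebra_simps intro: cong_trans)
          next
            case False
            with j have "[r j \<phi> + ?s * r j \<phi>0 = 0 + ?s * 0] (mod int p)"
              by (intro cong_add cong_mult cong_refl z \<phi>0) auto
            with 1 show ?thesis by (auto intro: cong_trans)
          qed
        qed
        with w [OF \<phi> \<phi>0(1), of ?s] have "[w \<phi> + ?s * w \<phi>0 = 0] (mod int p)"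
          using cong_sym cong_trans by blast
        then show ?thesis by (simp add: t_def algebra_simps)
      qed
    qed (use r in auto)
    then obtain \<omega> where \<omega>: "\<And>\<phi>. \<phi> \<in> F \<Longrightarrow> [w \<phi> - t * r i \<phi> = (\<Sum>j\<in>I. \<omega> j * r j \<phi>)] (mod int p)" by blast
    have *: "(\<Sum>j\<in>I. (\<omega>(i := t)) j * r j \<phi>) = (\<Sum>j\<in>I. \<omega> j * r j \<phi>)" for \<phi>
      using insert.hyps by (intro sum.cong) auto
    show ?thesis
    proof (intro exI [of _ "\<omega>(i := t)"] ballI)
      fix \<phi> assume "\<phi> \<in> F"
      from cong_add [OF \<omega> [OF this] cong_refl [of "t * r i \<phi>"]]
      show "[w \<phi> = (\<Sum>j\<in>insert i I. (\<omega>(i := t)) j * r j \<phi>)] (mod int p)"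
        using insert.hyps * [of \<phi>] by (simp add: add.commute)
    qed
  qed
qed

lemma sum_square_split:
  fixes f :: "nat \<Rightarrow> nat \<Rightarrow> int"
  shows "(\<Sum>i<n. \<Sum>j<n. f i j) = (\<Sum>i<n. \<Sum>j<i. f i j + f j i) + (\<Sum>i<n. f i i)"
  by (induction n) (simp_all add: sum.distrib)

lemma permutations_of_three:
  assumes "card {i, j, k} = 3" "{i', j', k'} = {i, j, k}"
  shows "(i', j', k') \<in> {(i, j, k), (i, k, j), (j, i, k), (j, k, i), (k, i, j), (k, j, i)}"
proof -
  have d: "a \<noteq> b \<and> a \<noteq> c \<and> b \<noteq> c" if "card {a, b, c} = 3" for a b c :: 'a
    using that by (auto simp: card_insert_if split: if_splits)
  have "i' \<in> {i, j, k}" "j' \<in> {i, j, k}" "k' \<in> {i, j, k}" using assms(2) by blast+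
  then show ?thesis using d [of i' j' k'] assms by auto
qed

section \<open>Relations between commutators of basis elements as alternating tensors\<close>

context class_two_basis
begin

abbreviation c :: "nat \<Rightarrow> nat \<Rightarrow> 'a" where "c i j \<equiv> commutator (x i) (x j)"

lemma Z_elementary_abelian: "elementary_abelian (G\<lparr>carrier := Z\<rparr>) p"
proof -
  interpret Zg: group "G\<lparr>carrier := Z\<rparr>" by (rule subgroup_imp_group [OF group_center_subgroup])
  have "comm_group (G\<lparr>carrier := Z\<rparr>)"
    by (rule Zg.group_comm_groupI) (simp add: Z_comm Z_carrier)
  moreover have "finite Z" using finite_carrier by (rule rev_finite_subset) (auto simp: Z_carrier)
  ultimately show ?thesis
    unfolding elementary_abelian_def elementary_abelian_axioms_def
    using prime_p exponent_p Z_carrier by (simp add: nat_pow_consistent [symmetric])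
qed

lemma hom_mod_Z_carrier [simp]: "hom_mod p (G\<lparr>carrier := Z\<rparr>) H \<chi> = hom_mod p G H \<chi>"
  by (simp add: hom_mod_def)

lemma hom_mod_c_swap:
  assumes \<chi>: "hom_mod p G Z \<chi>" and "i < n" "j < n"
  shows "[\<chi> (c j i) = - \<chi> (c i j)] (mod int p)" "[\<chi> (c i i) = 0] (mod int p)"
proof -
  have \<chi>1: "[\<chi> \<one> = 0] (mod int p)"
    using hom_mod_one [OF \<chi>] subgroup.one_closed [OF group_center_subgroup] by simp
  then show "[\<chi> (c i i) = 0] (mod int p)" using assms by (simp add: commutator_self)
  have "c j i \<otimes> c i j = \<one>" using assms commutator_swap [of "x i" "x j"] by simp
  moreover have "[\<chi> (c j i \<otimes> c i j) = \<chi> (c j i) + \<chi> (c i j)] (mod int p)"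
    using assms by (intro hom_mod_add [OF \<chi>] commutator_Z) simp_all
  ultimately have "[\<chi> (c j i) + \<chi> (c i j) = 0] (mod int p)" using \<chi>1 by (metis cong_sym cong_trans)
  then show "[\<chi> (c j i) = - \<chi> (c i j)] (mod int p)" by (simp add: cong_iff_dvd_diff)
qed

text \<open>The relations \<open>A\<close> are the coefficients that express \<open>\<chi> l v\<close> through the defining
  equations of the pairs \<open>(\<chi>, S)\<close>; the free choice of \<open>S\<close> makes them alternating.\<close>
lemma alternating_relations:
  assumes no: "\<And>\<chi> S l. (\<And>i j k. S i j k = S i k j) \<Longrightarrow> (\<And>k. k < n \<Longrightarrow> hom_mod p G Z (\<chi> k)) \<Longrightarrow>
      (\<And>i j k. i < n \<Longrightarrow> j < n \<Longrightarrow> k < n \<Longrightarrow> [\<chi> k (c i j) = S i j k - S j i k] (mod int p)) \<Longrightarrow>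
      l < n \<Longrightarrow> [\<chi> l v = (0::int)] (mod int p)"
    and l: "l < n"
  obtains A where "\<And>i j k. A i j k = - A j i k"
    "\<And>i j k. i < n \<Longrightarrow> j < n \<Longrightarrow> k < n \<Longrightarrow> [A i j k = - A i k j] (mod int p)"
    "\<And>\<chi> q. hom_mod p G Z \<chi> \<Longrightarrow> q < n \<Longrightarrow>
      [(\<Sum>i<n. \<Sum>j<i. A i j q * \<chi> (c i j)) = of_bool (l = q) * \<chi> v] (mod int p)"
proof -
  \<comment> \<open>The equations between characters and tensor are imposed only through the
    functionals \<open>r\<close>; inside \<open>F\<close> the two vary independently.\<close>
  define F :: "((nat \<Rightarrow> 'a \<Rightarrow> int) \<times> (nat \<Rightarrow> nat \<Rightarrow> nat \<Rightarrow> int)) set" where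
    "F = {(\<chi>, S). (\<forall>k<n. hom_mod p G Z (\<chi> k)) \<and> (\<forall>i j k. S i j k = S i k j)}"
  define comb where "comb \<phi> t \<psi> = ((\<lambda>k g. fst \<phi> k g + t * fst \<psi> k g), (\<lambda>i j k. snd \<phi> i j k + t * snd \<psi> i j k))"
    for \<phi> \<psi> :: "(nat \<Rightarrow> 'a \<Rightarrow> int) \<times> (nat \<Rightarrow> nat \<Rightarrow> nat \<Rightarrow> int)" and t
  define r where "r = (\<lambda>(i, j, k :: nat) (\<chi>, S). \<chi> k (c i j) - S i j k + S j i k :: int)"
  have "\<exists>\<omega>. \<forall>\<phi>\<in>F. [fst \<phi> l v = (\<Sum>s\<in>{..<n} \<times> {..<n} \<times> {..<n}. \<omega> s * r s \<phi>)] (mod int p)"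
  proof (rule common_kernel_combination [OF prime_p, where comb = comb])
    show "comb \<phi> t \<psi> \<in> F" if F: "\<phi> \<in> F" "\<psi> \<in> F" for \<phi> \<psi> t
    proof -
      obtain \<chi> S \<chi>' S' where [simp]: "\<phi> = (\<chi>, S)" "\<psi> = (\<chi>', S')" by (cases \<phi>, cases \<psi>)
      have "hom_mod p G Z (\<lambda>g. \<chi> k g + t * \<chi>' k g)" if k: "k < n" for k
        unfolding hom_mod_def
      proof (intro ballI)
        fix g h assume "g \<in> Z" "h \<in> Z"
        then have "[\<chi> k (g \<otimes> h) + t * \<chi>' k (g \<otimes> h) = (\<chi> k g + \<chi> k h) + t * (\<chi>' k g + \<chi>' k h)] (mod int p)"
          using F k by (intro cong_add cong_mult cong_refl hom_mod_add [of p G Z]) (auto simp: F_def)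
        then show "[\<chi> k (g \<otimes> h) + t * \<chi>' k (g \<otimes> h) = \<chi> k g + t * \<chi>' k g + (\<chi> k h + t * \<chi>' k h)] (mod int p)"
          by (simp add: algebra_simps)
      qed
      then show ?thesis using F by (auto simp: F_def comb_def)
    qed
    show "[r s (comb \<phi> t \<psi>) = r s \<phi> + t * r s \<psi>] (mod int p)" for s \<phi> \<psi> t
      by (cases s, cases \<phi>, cases \<psi>) (simp add: r_def comb_def algebra_simps)
    show "[fst \<phi> l v = 0] (mod int p)"
      if \<phi>: "\<phi> \<in> F" and z: "\<And>s. s \<in> {..<n} \<times> {..<n} \<times> {..<n} \<Longrightarrow> [r s \<phi> = 0] (mod int p)" for \<phi>
    proof (rule no [of "snd \<phi>" "fst \<phi>" l])
      show "snd \<phi> i j k = snd \<phi> i k j" for i j k using \<phi> by (auto simp: F_def)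
      show "hom_mod p G Z (fst \<phi> k)" if "k < n" for k using \<phi> that by (auto simp: F_def)
      show "[fst \<phi> k (c i j) = snd \<phi> i j k - snd \<phi> j i k] (mod int p)"
        if "i < n" "j < n" "k < n" for i j k
        using z [of "(i, j, k)"] that by (simp add: r_def case_prod_beta cong_iff_dvd_diff algebra_simps)
    qed (rule l)
  qed (simp_all add: comb_def)
  then obtain \<omega> where \<omega>0: "\<And>\<phi>. \<phi> \<in> F \<Longrightarrow>
      [fst \<phi> l v = (\<Sum>s\<in>{..<n} \<times> {..<n} \<times> {..<n}. \<omega> s * r s \<phi>)] (mod int p)"
    by blast
  have \<omega>: "[\<chi> l v = (\<Sum>i<n. \<Sum>j<n. \<Sum>k<n. \<omega> (i, j, k) * (\<chi> k (c i j) - S i j k + S j i k))] (mod int p)"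
    if "\<And>k. k < n \<Longrightarrow> hom_mod p G Z (\<chi> k)" "\<And>i j k. S i j k = S i k j" for \<chi> S
  proof -
    have "(\<chi>, S) \<in> F" unfolding F_def using that by blast
    from \<omega>0 [OF this] show ?thesis
      by (simp add: r_def sum.cartesian_product' case_prod_beta)
  qed
  \<comment> \<open>Modulo \<open>p\<close> the functional \<open>r (i, j, k)\<close> changes sign
    when \<open>i\<close> and \<open>j\<close> are swapped, so only this part of \<omega>
    counts.\<close>
  define A where "A i j k = \<omega> (i, j, k) - \<omega> (j, i, k)" for i j k
  show thesis
  proof (rule that [of A])
    show "A i j k = - A j i k" for i j k by (simp add: A_def)
    show "[A i0 j0 k0 = - A i0 k0 j0] (mod int p)" if b: "i0 < n" "j0 < n" "k0 < n" for i0 j0 k0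
    proof -
      \<comment> \<open>With zero characters and this symmetrised unit tensor, the expansion by
        \<omega> isolates \<open>A i0 j0 k0\<close> and \<open>A i0 k0 j0\<close>. The sum of two
        terms also covers \<open>j0 = k0\<close>.\<close>
      define S :: "nat \<Rightarrow> nat \<Rightarrow> nat \<Rightarrow> int" where
        "S i j k = (if i = i0 \<and> j = j0 \<and> k = k0 then 1 else 0) + (if i = i0 \<and> j = k0 \<and> k = j0 then 1 else 0)"
        for i j k
      have eval: "(\<Sum>i<n. \<Sum>j<n. \<Sum>k<n. f i j k * S i j k) = f i0 j0 k0 + f i0 k0 j0" for f
      proof -
        have delta: "(\<Sum>i<n. \<Sum>j<n. \<Sum>k<n. if i = i0 \<and> j = j1 \<and> k = k1 then f i j k else 0) = f i0 j1 k1"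
          if "j1 < n" "k1 < n" for j1 k1
        proof -
          have "(\<Sum>k<n. if i = i0 \<and> j = j1 \<and> k = k1 then f i j k else 0) = (if i = i0 \<and> j = j1 then f i j k1 else 0)"
            for i j using that by (cases "i = i0 \<and> j = j1") auto
          moreover have "(\<Sum>j<n. if i = i0 \<and> j = j1 then f i j k1 else 0) = (if i = i0 then f i j1 k1 else 0)"
            for i using that by (cases "i = i0") auto
          ultimately show ?thesis using b by simp
        qed
        have "f i j k * S i j k = (if i = i0 \<and> j = j0 \<and> k = k0 then f i j k else 0) +
            (if i = i0 \<and> j = k0 \<and> k = j0 then f i j k else 0)" for i j k
          unfolding S_def distrib_left by (intro arg_cong2 [where f = "(+)"]) simp_all
        then show ?thesis using b by (simp only: sum.distrib delta)
      qed
      have "[0 = (\<Sum>i<n. \<Sum>j<n. \<Sum>k<n. \<omega> (i, j, k) * (0 - S i j k + S j i k))] (mod int p)"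
      proof (rule \<omega> [of "\<lambda>_ _. 0" S])
        show "S i j k = S i k j" for i j k unfolding S_def
          by (cases "i = i0"; cases "j = j0"; cases "j = k0"; cases "k = j0"; cases "k = k0") simp_all
      qed (simp add: hom_mod_def)
      also have "(\<Sum>i<n. \<Sum>j<n. \<Sum>k<n. \<omega> (i, j, k) * (0 - S i j k + S j i k)) =
          (\<Sum>i<n. \<Sum>j<n. \<Sum>k<n. \<omega> (i, j, k) * S j i k) - (\<Sum>i<n. \<Sum>j<n. \<Sum>k<n. \<omega> (i, j, k) * S i j k)"
      proof -
        have "\<omega> (i, j, k) * (0 - S i j k + S j i k) = \<omega> (i, j, k) * S j i k - \<omega> (i, j, k) * S i j k" for i j k
          by (simp add: right_diff_distrib)
        then show ?thesis by (simp only: sum_subtractf)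
      qed
      also have "(\<Sum>i<n. \<Sum>j<n. \<Sum>k<n. \<omega> (i, j, k) * S j i k) =
          (\<Sum>i<n. \<Sum>j<n. \<Sum>k<n. \<omega> (j, i, k) * S i j k)"
        by (rule sum.swap)
      also have "\<dots> - (\<Sum>i<n. \<Sum>j<n. \<Sum>k<n. \<omega> (i, j, k) * S i j k) = - A i0 j0 k0 - A i0 k0 j0"
        by (simp only: eval) (simp add: A_def)
      finally show ?thesis by (simp add: cong_iff_dvd_diff algebra_simps)
    qed
    show "[(\<Sum>i<n. \<Sum>j<i. A i j q * \<chi> (c i j)) = of_bool (l = q) * \<chi> v] (mod int p)"
      if \<chi>: "hom_mod p G Z \<chi>" and q: "q < n" for \<chi> q
    proof -
      let ?f = "\<lambda>i j. \<omega> (i, j, q) * \<chi> (c i j)"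
      \<comment> \<open>Here the tensor is zero and \<chi> is placed at the index \<open>q\<close>
        alone.\<close>
      have "[of_bool (l = q) * \<chi> v = (\<Sum>i<n. \<Sum>j<n. \<Sum>k<n. \<omega> (i, j, k) * (of_bool (k = q) * \<chi> (c i j) - 0 + 0))] (mod int p)"
        by (rule \<omega> [of "\<lambda>k g. of_bool (k = q) * \<chi> g" "\<lambda>_ _ _. 0"])
          (use \<chi> in \<open>auto simp: hom_mod_def of_bool_def\<close>)
      also have "(\<Sum>i<n. \<Sum>j<n. \<Sum>k<n. \<omega> (i, j, k) * (of_bool (k = q) * \<chi> (c i j) - 0 + 0)) =
          (\<Sum>i<n. \<Sum>j<n. ?f i j)"
      proof (intro sum.cong refl)
        fix i j
        have "(\<Sum>k<n. \<omega> (i, j, k) * (of_bool (k = q) * \<chi> (c i j) - 0 + 0)) =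
            (\<Sum>k<n. if k = q then ?f i j else 0)"
          by (intro sum.cong) auto
        then show "(\<Sum>k<n. \<omega> (i, j, k) * (of_bool (k = q) * \<chi> (c i j) - 0 + 0)) = ?f i j"
          using q by simp
      qed
      also have "(\<Sum>i<n. \<Sum>j<n. ?f i j) = (\<Sum>i<n. \<Sum>j<i. ?f i j + ?f j i) + (\<Sum>i<n. ?f i i)"
        by (rule sum_square_split)
      also have "[(\<Sum>i<n. \<Sum>j<i. ?f i j + ?f j i) + (\<Sum>i<n. ?f i i) =
          (\<Sum>i<n. \<Sum>j<i. ?f i j + \<omega> (j, i, q) * (- \<chi> (c i j))) + (\<Sum>i<n. \<omega> (i, i, q) * 0)] (mod int p)"
        using \<chi> by (intro cong_add cong_sum cong_mult cong_refl hom_mod_c_swap) auto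
      also have "(\<Sum>i<n. \<Sum>j<i. ?f i j + \<omega> (j, i, q) * (- \<chi> (c i j))) + (\<Sum>i<n. \<omega> (i, i, q) * 0) =
          (\<Sum>i<n. \<Sum>j<i. A i j q * \<chi> (c i j))"
        by (simp add: A_def algebra_simps)
      finally show ?thesis by (rule cong_sym)
    qed
  qed
qed

end

text \<open>Each new generator is already present or multiplies the order by \<open>p\<close>. The
  order of the derived subgroup will be bounded in this way.\<close>

lemma (in elementary_abelian) exists_small_subgroup:
  assumes "finite Y" "Y \<subseteq> carrier G"
  shows "\<exists>H. subgroup H G \<and> Y \<subseteq> H \<and> card H \<le> p ^ card Y"
  using assms
proof (induction Y rule: finite_induct)
  case empty
  show ?case by (intro exI [of _ "{\<one>}"]) (simp add: triv_subgroup)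
next
  case (insert y Y)
  then obtain H where H: "subgroup H G" "Y \<subseteq> H" "card H \<le> p ^ card Y" by auto
  have y: "y \<in> carrier G" using insert.prems by simp
  have p1: "1 \<le> p" using prime_gt_0_nat [OF prime_p] by simp
  show ?case
  proof (cases "y \<in> H")
    case True
    have "p ^ card Y \<le> p ^ card (insert y Y)" using insert.hyps p1 by (simp add: power_increasing)
    then have "card H \<le> p ^ card (insert y Y)" using H(3) by linarith
    with True H show ?thesis by blast
  next
    case False
    have "card (adjoin H y) \<le> p ^ card (insert y Y)"
      using H insert.hyps by (simp add: card_adjoin [OF H(1) y False])
    then show ?thesis
      using H mem_adjoin [OF H(1) y] subset_adjoin [OF H(1) y] subgroup_adjoin [OF H(1) y] by blast
  qed
qed

section \<open>Leading terms and the two counting estimates\<close>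

context class_two_basis
begin

text \<open>The leading terms of the relations between the \<open>c i j\<close> modulo \<open>v\<close>, expressed by duality.\<close>
definition edges :: "'a \<Rightarrow> nat set set" where
  "edges v = {e. e \<subseteq> {..<n} \<and> card e = 2 \<and> (\<forall>\<chi>. hom_mod p G Z \<chi> \<longrightarrow> [\<chi> v = 0] (mod int p) \<longrightarrow>
    (\<forall>i j. j < i \<longrightarrow> i < n \<longrightarrow> set_encode {i, j} < set_encode e \<longrightarrow> [\<chi> (c i j) = 0] (mod int p)) \<longrightarrow>
    (\<forall>i j. j < i \<longrightarrow> e = {i, j} \<longrightarrow> [\<chi> (c i j) = 0] (mod int p)))}"

text \<open>The sets \<open>{i, j, k}\<close> are ordered by \<open>set_encode\<close>, an order that is preserved when a common
  element is removed. Hence if \<open>{i, j, k}\<close> is maximal with \<open>B i j k\<close> nonzero, then the relation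
  at each of its elements \<open>q\<close> expresses the commutator of the other two by smaller ones.\<close>
lemma alternating_zero_if_zero_on_triangles:
  assumes swap1: "\<And>i j k. B i j k = - B j i k"
    and swap2: "\<And>i j k. i < n \<Longrightarrow> j < n \<Longrightarrow> k < n \<Longrightarrow> [B i j k = - B i k j] (mod int p)"
    and rel: "\<And>\<chi> q. hom_mod p G Z \<chi> \<Longrightarrow> q < n \<Longrightarrow>
      [(\<Sum>i<n. \<Sum>j<i. B i j q * \<chi> (c i j)) = t q * \<chi> v] (mod int p)"
    and tri: "\<And>T. T \<in> triangles (edges v) \<Longrightarrow> \<exists>i j k. T = {i, j, k} \<and> int p dvd B i j k"
    and ijk: "i < n" "j < n" "k < n"
  shows "int p dvd B i j k"
proof (rule ccontr)
  assume nz: "\<not> int p dvd B i j k"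
  define P where "P i j k \<longleftrightarrow> int p dvd B i j k" for i j k
  have P1: "P i j k \<longleftrightarrow> P j i k" for i j k
    unfolding P_def using swap1 [of i j k] by simp
  have P2: "P i j k \<longleftrightarrow> P i k j" if "i < n" "j < n" "k < n" for i j k
  proof -
    have "int p dvd B i j k + B i k j" using swap2 [OF that] by (simp add: cong_iff_dvd_diff)
    then show ?thesis unfolding P_def by (meson dvd_add_left_iff dvd_add_right_iff)
  qed
  have diag: "P i i k" for i k unfolding P_def using swap1 [of i i k] by simp
  have diag': "P i k k" if "i < n" "k < n" for i k
  proof -
    have "int p dvd 2 * B i k k"
      using swap2 [OF that(1,2,2)] by (simp add: cong_iff_dvd_diff)
    \<comment> \<open>Alternation as a change of sign only kills twice the diagonal entry;
      \<open>p\<close> is odd.\<close>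
    moreover have "coprime (int p) 2" using odd_p by simp
    ultimately show ?thesis unfolding P_def by (simp add: coprime_dvd_mult_right_iff)
  qed
  have distinct: "i \<noteq> j \<and> i \<noteq> k \<and> j \<noteq> k" if "\<not> P i j k" "i < n" "j < n" "k < n" for i j k
    using that diag diag' P1 by metis
  have perm: "P i' j' k' \<longleftrightarrow> P i j k"
    if "card {i, j, k} = 3" "{i', j', k'} = {i, j, k}" "i < n" "j < n" "k < n" for i j k i' j' k'
    using permutations_of_three [OF that(1,2)] that(3-5) P1 P2 by auto
  define \<T> where "\<T> = {T. \<exists>i j k. i < n \<and> j < n \<and> k < n \<and> T = {i, j, k} \<and> \<not> P i j k}"
  have fin: "finite \<T>" by (rule finite_subset [of _ "Pow {..<n}"]) (auto simp: \<T>_def)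
  have "{i, j, k} \<in> \<T>" using nz ijk by (auto simp: \<T>_def P_def)
  then have "Max (set_encode ` \<T>) \<in> set_encode ` \<T>" using fin by (intro Max_in) auto
  then obtain T where T: "T \<in> \<T>" "set_encode T = Max (set_encode ` \<T>)" by auto
  then have max: "set_encode T' \<le> set_encode T" if "T' \<in> \<T>" for T'
    using that fin by simp
  from T(1) obtain i j k where Tijk: "i < n" "j < n" "k < n" "T = {i, j, k}" "\<not> P i j k"
    by (auto simp: \<T>_def)
  have cT: "card T = 3" using distinct [OF Tijk(5,1-3)] Tijk(4) by simp
  then have cT': "card {i, j, k} = 3" using Tijk by simp
  have Tn: "T \<subseteq> {..<n}" "finite T" using Tijk by auto
  have "T \<in> triangles (edges v)"
    unfolding triangles_def
  proof (intro CollectI conjI allI impI cT)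
    fix e assume e: "e \<subseteq> T \<and> card e = 2"
    then have fe: "finite e" using finite_subset Tn by blast
    from e obtain i0 j0 where e_eq: "e = {i0, j0}" "j0 < i0"
    proof -
      from e obtain y z where "e = {y, z}" "y \<noteq> z" by (auto simp: card_2_iff)
      then show thesis using that [of y z] that [of z y] by (cases "z < y") (auto simp: insert_commute)
    qed
    have "card (T - e) = 1" using e cT fe by (simp add: card_Diff_subset)
    then obtain q where q: "T - e = {q}" by (auto simp: card_1_singleton_iff)
    then have Tq: "T = {i0, j0, q}" and q_e: "q \<notin> e" using e e_eq by auto
    have b: "i0 < n" "j0 < n" "q < n" using Tn Tq by auto
    have nP: "\<not> P i0 j0 q" using perm [OF cT', of i0 j0 q] Tq Tijk by simp
    show "e \<in> edges v"
      unfolding edges_def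
    proof (intro CollectI conjI allI impI)
      show "e \<subseteq> {..<n}" "card e = 2" using e Tn by auto
    next
      fix \<chi> i j
      assume \<chi>: "hom_mod p G Z \<chi>" "[\<chi> v = 0] (mod int p)"
        and less: "\<forall>i j. j < i \<longrightarrow> i < n \<longrightarrow> set_encode {i, j} < set_encode e \<longrightarrow> [\<chi> (c i j) = 0] (mod int p)"
        and ij: "j < i" "e = {i, j}"
      have ij0: "i = i0" "j = j0" using ij e_eq by (auto simp: doubleton_eq_iff)
      let ?f = "\<lambda>i j. B i j q * \<chi> (c i j)"
      \<comment> \<open>Of the relation at \<open>q\<close> only the term at \<open>e\<close>
        survives: a pair with a smaller code is killed by \<chi>, and a pair with a larger code has
        coefficient zero, since its union with \<open>q\<close> would otherwise exceed the maximal
        \<open>T\<close>.\<close>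
      have "[?f i j = (if i = i0 \<and> j = j0 then ?f i j else 0)] (mod int p)"
        if "i < n" "j < i" for i j
      proof (cases "i = i0 \<and> j = j0")
        case False
        have "int p dvd ?f i j"
        proof (cases "P i j q \<or> set_encode {i, j} < set_encode e")
          case True
          then show ?thesis using less that by (auto simp: P_def cong_0_iff)
        next
          case nF: False
          have ijq: "q \<noteq> i" "q \<noteq> j" using distinct [of i j q] nF that b by auto
          have "{i, j} \<noteq> e" using False that e_eq by (auto simp: doubleton_eq_iff)
          then have "set_encode {i, j} \<noteq> set_encode e" using fe by (simp add: set_encode_eq)
          with nF have "set_encode e < set_encode {i, j}" by auto
          moreover have "set_encode (insert q {i, j}) = 2 ^ q + set_encode {i, j}"
            using ijq by (subst set_encode_insert) auto
          moreover have "set_encode (insert q e) = 2 ^ q + set_encode e"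
            using q_e fe by (subst set_encode_insert) auto
          moreover have "insert q e = T" using Tq e_eq by auto
          ultimately have "set_encode T < set_encode (insert q {i, j})" by simp
          then have "insert q {i, j} \<notin> \<T>" using max leD by blast
          moreover have "insert q {i, j} = {i, j, q}" by auto
          ultimately show ?thesis
            using nF that b by (auto simp: \<T>_def)
        qed
        with False show ?thesis by (simp add: cong_0_iff)
      qed simp
      then have "[(\<Sum>i<n. \<Sum>j<i. ?f i j) = (\<Sum>i<n. \<Sum>j<i. if i = i0 \<and> j = j0 then ?f i j else 0)] (mod int p)"
        by (intro cong_sum) auto
      also have "(\<Sum>i<n. \<Sum>j<i. if i = i0 \<and> j = j0 then ?f i j else 0) =
          (\<Sum>i<n. if i = i0 then (\<Sum>j<i. if j = j0 then ?f i j else 0) else 0)"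
        by (intro sum.cong) auto
      also have "\<dots> = ?f i0 j0" using b e_eq by simp
      finally have "[?f i0 j0 = t q * \<chi> v] (mod int p)"
        using rel [OF \<chi>(1) b(3)] by (meson cong_sym cong_trans)
      moreover have "[t q * \<chi> v = t q * 0] (mod int p)" by (intro cong_mult \<chi> cong_refl)
      ultimately have "int p dvd ?f i0 j0" by (metis cong_0_iff cong_trans mult_zero_right)
      then have "int p dvd \<chi> (c i0 j0)"
        using nP prime_p prime_dvd_mult_iff [of "int p"] by (simp add: P_def)
      then show "[\<chi> (c i j) = 0] (mod int p)" using ij0 by (simp add: cong_0_iff)
    qed
  qed
  from tri [OF this] obtain i' j' k' where "T = {i', j', k'}" "P i' j' k'" by (auto simp: P_def)
  then show False using perm [OF cT', of i' j' k'] Tijk by simp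
qed

lemma edges_subset: "edges v \<subseteq> {e. e \<subseteq> {..<n} \<and> card e = 2}"
  unfolding edges_def by blast

lemma finite_pairs: "finite {e. e \<subseteq> {..<n} \<and> card e = 2}"
  by (rule finite_subset [of _ "Pow {..<n}"]) auto

lemma finite_edges: "finite (edges v)"
  by (rule finite_subset [OF edges_subset finite_pairs])

text \<open>A combination of the \<open>A l\<close> is determined by its values on the triangles: if
  these vanish, so does the combination, and its contraction at \<open>q\<close> is the
  \<open>q\<close>-th coefficient times \<open>v\<close>. Comparing \<open>p ^ n\<close> with
  \<open>p ^ card (triangles (edges v))\<close> takes the place of a dimension count.\<close>

lemma n_le_card_triangles:
  assumes v: "v \<in> Z" "v \<noteq> \<one>"
    and A1: "\<And>l i j k. l < n \<Longrightarrow> A l i j k = - A l j i k"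
    and A2: "\<And>l i j k. l < n \<Longrightarrow> i < n \<Longrightarrow> j < n \<Longrightarrow> k < n \<Longrightarrow> [A l i j k = - A l i k j] (mod int p)"
    and A3: "\<And>l \<chi> q. l < n \<Longrightarrow> hom_mod p G Z \<chi> \<Longrightarrow> q < n \<Longrightarrow>
      [(\<Sum>i<n. \<Sum>j<i. A l i j q * \<chi> (c i j)) = of_bool (l = q) * \<chi> v] (mod int p)"
  shows "n \<le> card (triangles (edges v))"
proof -
  interpret Zg: elementary_abelian "G\<lparr>carrier := Z\<rparr>" p by (rule Z_elementary_abelian)
  let ?E = "edges v"
  \<comment> \<open>This character reads off the coefficients from multiples of
    \<open>v\<close>.\<close>
  obtain \<chi> where \<chi>: "hom_mod p G Z \<chi>" "[\<chi> v = 1] (mod int p)"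
    using Zg.hom_mod_separate [OF Zg.triv_subgroup, of v] v by auto
  have fin: "finite (triangles ?E)"
    using finite_edges by (intro finite_subset [OF triangles_subset_Pow]) (auto simp: edges_def finite_subset)
  have "\<exists>i j k. T = {i, j, k}" if "T \<in> triangles ?E" for T
    using that by (auto simp: triangles_def card_3_iff)
  then obtain f1 f2 f3 where f: "\<And>T. T \<in> triangles ?E \<Longrightarrow> T = {f1 T, f2 T, f3 T}" by metis
  have p0: "0 < p" using prime_gt_0_nat [OF prime_p] .
  define \<Phi> where "\<Phi> t = (\<lambda>T\<in>triangles ?E. (\<Sum>l<n. t l * A l (f1 T) (f2 T) (f3 T)) mod int p)"
    for t :: "nat \<Rightarrow> int"
  have "inj_on \<Phi> ({..<n} \<rightarrow>\<^sub>E {0..<int p})"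
  proof (rule inj_onI)
    fix t t' assume t: "t \<in> {..<n} \<rightarrow>\<^sub>E {0..<int p}" and t': "t' \<in> {..<n} \<rightarrow>\<^sub>E {0..<int p}"
      and eq: "\<Phi> t = \<Phi> t'"
    define B where "B i j k = (\<Sum>l<n. (t l - t' l) * A l i j k)" for i j k
    have rel: "[(\<Sum>i<n. \<Sum>j<i. B i j q * \<chi> (c i j)) = (t q - t' q) * \<chi> v] (mod int p)"
      if \<chi>: "hom_mod p G Z \<chi>" and q: "q < n" for \<chi> q
    proof -
      have "(\<Sum>i<n. \<Sum>j<i. B i j q * \<chi> (c i j)) =
          (\<Sum>i<n. \<Sum>l<n. (t l - t' l) * (\<Sum>j<i. A l i j q * \<chi> (c i j)))"
        unfolding B_def sum_distrib_left sum_distrib_right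
        by (subst sum.swap) (simp add: mult.assoc)
      also have "\<dots> = (\<Sum>l<n. (t l - t' l) * (\<Sum>i<n. \<Sum>j<i. A l i j q * \<chi> (c i j)))"
        by (subst sum.swap) (simp add: sum_distrib_left)
      also have "[(\<Sum>l<n. (t l - t' l) * (\<Sum>i<n. \<Sum>j<i. A l i j q * \<chi> (c i j))) =
          (\<Sum>l<n. (t l - t' l) * (of_bool (l = q) * \<chi> v))] (mod int p)"
        using \<chi> q by (intro cong_sum cong_mult cong_refl A3) auto
      also have "(\<Sum>l<n. (t l - t' l) * (of_bool (l = q) * \<chi> v)) = (t q - t' q) * \<chi> v"
        using q by (simp add: of_bool_def if_distrib if_distribR cong: if_cong)
      finally show ?thesis .
    qed
    have B0: "int p dvd B i j k" if "i < n" "j < n" "k < n" for i j k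
    proof (rule alternating_zero_if_zero_on_triangles [of B, OF _ _ rel _ that])
      show "B i j k = - B j i k" for i j k
        unfolding B_def sum_negf [symmetric] by (intro sum.cong refl) (subst A1, auto)
      show "[B i j k = - B i k j] (mod int p)" if "i < n" "j < n" "k < n" for i j k
      proof -
        have "[B i j k = (\<Sum>l<n. (t l - t' l) * (- A l i k j))] (mod int p)"
          unfolding B_def using that by (intro cong_sum cong_mult cong_refl A2) auto
        then show ?thesis by (simp add: B_def sum_negf)
      qed
      fix T assume T: "T \<in> triangles ?E"
      have "[(\<Sum>l<n. t l * A l (f1 T) (f2 T) (f3 T)) = (\<Sum>l<n. t' l * A l (f1 T) (f2 T) (f3 T))] (mod int p)"
        using fun_cong [OF eq, of T] T by (simp add: \<Phi>_def cong_def)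
      then have "int p dvd B (f1 T) (f2 T) (f3 T)"
        by (simp add: B_def cong_iff_dvd_diff left_diff_distrib sum_subtractf)
      then show "\<exists>i j k. T = {i, j, k} \<and> int p dvd B i j k" using f [OF T] by blast
    qed
    show "t = t'"
    proof (rule PiE_ext [OF t t'])
      fix q assume q: "q \<in> {..<n}"
      have "int p dvd (\<Sum>i<n. \<Sum>j<i. B i j q * \<chi> (c i j))"
        using q B0 by (intro dvd_sum dvd_mult2) auto
      then have "[(\<Sum>i<n. \<Sum>j<i. B i j q * \<chi> (c i j)) = 0] (mod int p)" by (simp add: cong_0_iff)
      with rel [OF \<chi>(1), of q] q have "[(t q - t' q) * \<chi> v = 0] (mod int p)"
        by (meson cong_sym cong_trans lessThan_iff)
      moreover have "[(t q - t' q) * \<chi> v = (t q - t' q) * 1] (mod int p)"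
        by (intro cong_mult cong_refl \<chi>)
      ultimately have "[(t q - t' q) * 1 = 0] (mod int p)" by (meson cong_sym cong_trans)
      then have "[t q = t' q] (mod int p)" by (simp add: cong_0_iff cong_iff_dvd_diff)
      moreover have "t q \<in> {0..<int p}" "t' q \<in> {0..<int p}" using t t' q by blast+
      ultimately show "t q = t' q" by (simp add: cong_def)
    qed
  qed
  moreover have "\<Phi> ` ({..<n} \<rightarrow>\<^sub>E {0..<int p}) \<subseteq> triangles ?E \<rightarrow>\<^sub>E {0..<int p}"
  proof (rule image_subsetI)
    show "\<Phi> t \<in> triangles ?E \<rightarrow>\<^sub>E {0..<int p}" for t
      unfolding \<Phi>_def using p0 by (intro restrict_PiE_iff [THEN iffD2] ballI) simp
  qed
  moreover have "finite (triangles ?E \<rightarrow>\<^sub>E {0..<int p})" using fin by (intro finite_PiE) auto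
  ultimately have "card ({..<n} \<rightarrow>\<^sub>E {0..<int p}) \<le> card (triangles ?E \<rightarrow>\<^sub>E {0..<int p})"
    by (rule card_inj_on_le)
  then have "p ^ n \<le> p ^ card (triangles ?E)" using fin by (simp add: card_PiE)
  then show ?thesis using power_le_imp_le_exp prime_gt_1_nat [OF prime_p] by blast
qed

text \<open>A commutator at an edge is expressed by \<open>v\<close> and commutators at smaller
  pairs. Hence a subgroup of the centre that holds \<open>v\<close> and the commutators at all
  non-edges contains [G,G].\<close>

lemma card_derived_le:
  assumes v: "v \<in> Z"
  shows "card (derived G (carrier G)) \<le> p ^ (1 + ((n choose 2) - card (edges v)))"
proof -
  interpret Zg: elementary_abelian "G\<lparr>carrier := Z\<rparr>" p by (rule Z_elementary_abelian)
  let ?E = "edges v"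
  define N where "N = {e. e \<subseteq> {..<n} \<and> card e = 2} - ?E"
  \<comment> \<open>The larger index comes first, to match the orientation \<open>j < i\<close> in
    \<open>edges\<close>.\<close>
  define ce where "ce e = c (Max e) (Min e)" for e
  have finN: "finite N" unfolding N_def by (rule finite_Diff [OF finite_pairs])
  have cN: "card N = (n choose 2) - card ?E"
    unfolding N_def using card_Diff_subset [OF finite_edges edges_subset] n_subsets [of "{..<n}" 2] by simp
  have ce_eq: "ce {i, j} = c i j" if "j < i" for i j
    using that by (simp add: ce_def max_def min_def)
  have ceZ: "ce e \<in> Z" if "e \<in> N" for e
  proof -
    have "card e = 2" "finite e" "e \<subseteq> {..<n}" using that by (auto simp: N_def intro: card_ge_0_finite)
    then have "Max e \<in> e" "Min e \<in> e" by (auto intro!: Max_in Min_in)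
    with \<open>e \<subseteq> {..<n}\<close> show ?thesis unfolding ce_def by (intro commutator_Z x_closed) auto
  qed
  have finY: "finite (insert v (ce ` N))" using finN by simp
  have YZ: "insert v (ce ` N) \<subseteq> carrier (G\<lparr>carrier := Z\<rparr>)" using v ceZ by auto
  obtain H where H: "subgroup H (G\<lparr>carrier := Z\<rparr>)" "insert v (ce ` N) \<subseteq> H"
      "card H \<le> p ^ card (insert v (ce ` N))"
    using Zg.exists_small_subgroup [OF finY YZ] by blast
  have HG: "subgroup H G" by (rule incl_subgroup [OF group_center_subgroup H(1)])
  \<comment> \<open>Induction on the code of the pair: at an edge, the definition of
    \<open>edges\<close> reduces the claim to smaller pairs; at a non-edge, the commutator lies in
    \<open>H\<close>.\<close>
  have kills: "[\<chi> (c i j) = 0] (mod int p)"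
    if \<chi>: "hom_mod p G Z \<chi>" and \<chi>H: "\<And>h. h \<in> H \<Longrightarrow> [\<chi> h = 0] (mod int p)" and "j < i" "i < n" for \<chi> i j
    using that(3,4)
  proof (induction "set_encode {i, j}" arbitrary: i j rule: less_induct)
    case less
    show ?case
    proof (cases "{i, j} \<in> ?E")
      case True
      then show ?thesis
        using \<chi> \<chi>H H(2) less unfolding edges_def by auto
    next
      case False
      then have "{i, j} \<in> N" using less.prems by (auto simp: N_def)
      then have "c i j \<in> H" using H(2) ce_eq less.prems by (metis image_subset_iff insert_subset)
      then show ?thesis by (rule \<chi>H)
    qed
  qed
  have comm_H: "commutator g h \<in> H" if gh: "g \<in> carrier G" "h \<in> carrier G" for g h
  proof (rule ccontr)
    assume notin: "commutator g h \<notin> H"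
    then obtain \<chi> where \<chi>: "hom_mod p G Z \<chi>" "\<And>h. h \<in> H \<Longrightarrow> [\<chi> h = 0] (mod int p)"
      "[\<chi> (commutator g h) = 1] (mod int p)"
      using Zg.hom_mod_separate [OF H(1), of "commutator g h"] commutator_Z [OF gh] by auto
    have c0: "[\<chi> (c i j) = 0] (mod int p)" if "i < n" "j < n" for i j
    proof -
      consider "j < i" | "i = j" | "i < j" by linarith
      then show ?thesis
      proof cases
        case 1
        then show ?thesis using kills [OF \<chi>(1,2)] that by blast
      next
        case 2
        then show ?thesis using hom_mod_c_swap(2) [OF \<chi>(1)] that by blast
      next
        case 3
        then have "[- \<chi> (c j i) = - 0] (mod int p)"
          using kills [OF \<chi>(1,2) 3] that by (simp only: cong_minus_minus_iff)
        with hom_mod_c_swap(1) [OF \<chi>(1), of j i] that show ?thesis by (auto intro: cong_trans)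
      qed
    qed
    have c_gh: "[\<chi> (commutator g h) = (\<Sum>i<n. \<Sum>j<n. a i g * a j h * 0)] (mod int p)"
      using hom_mod_commutator [OF \<chi>(1) gh]
      by (rule cong_trans) (intro cong_sum cong_mult cong_refl c0, auto)
    have "[1 = 0] (mod int p)" using cong_trans [OF cong_sym [OF \<chi>(3)] c_gh] by simp
    then show False using prime_gt_1_nat [OF prime_p] by (simp add: cong_def)
  qed
  have "derived G (carrier G) \<subseteq> H"
    unfolding derived_def by (rule generate_subgroup_incl [OF _ HG]) (use comm_H in \<open>auto simp: commutator_def\<close>)
  moreover have "finite H" using HG finite_carrier finite_subset subgroup.subset by metis
  ultimately have "card (derived G (carrier G)) \<le> card H" by (rule card_mono [rotated])
  also have "\<dots> \<le> p ^ card (insert v (ce ` N))" by (rule H(3))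
  also have "\<dots> \<le> p ^ (1 + card N)"
  proof (rule power_increasing)
    have "card (insert v (ce ` N)) \<le> Suc (card (ce ` N))" by (rule card_insert_le_m1) simp_all
    also have "card (ce ` N) \<le> card N" by (rule card_image_le [OF finN])
    finally show "card (insert v (ce ` N)) \<le> 1 + card N" by simp
    show "1 \<le> p" using prime_gt_0_nat [OF prime_p] by simp
  qed
  finally show ?thesis by (simp add: cN)
qed

lemma capable_if_few_relations:
  assumes m: "card (derived G (carrier G)) = p ^ m"
    and f: "magidin_f ((n choose 2) - m + 1) < n"
  shows "capable G"
proof (rule capable_of_cocycles [OF group_axioms prime_gt_0_nat [OF prime_p]], rule ccontr)
  fix v assume v: "v \<in> Z" "v \<noteq> \<one>"
    and no: "\<not> (\<exists>c. two_cocycle p G c \<and> (\<exists>h\<in>carrier G. \<not> [c v h = c h v] (mod int p)))"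
  \<comment> \<open>The cocycle built from \<chi> and \<open>S\<close> has values at (v, x l) and (x
    l, v) that differ by \<open>2 * \<chi> l v\<close>. As no cocycle detects \<open>v\<close>, this
    is zero modulo \<open>p\<close>, and \<open>p\<close> is odd.\<close>
  have van: "[\<chi> l v = 0] (mod int p)"
    if S: "\<And>i j k. S i j k = S i k j" and \<chi>: "\<And>k. k < n \<Longrightarrow> hom_mod p G Z (\<chi> k)"
      and \<chi>S: "\<And>i j k. i < n \<Longrightarrow> j < n \<Longrightarrow> k < n \<Longrightarrow> [\<chi> k (c i j) = S i j k - S j i k] (mod int p)"
      and l: "l < n" for \<chi> S l
  proof -
    obtain \<gamma> where \<gamma>: "two_cocycle p G \<gamma>"
      "\<And>z h. z \<in> Z \<Longrightarrow> h \<in> carrier G \<Longrightarrow> [\<gamma> z h = 2 * (\<Sum>k<n. \<chi> k z * a k h)] (mod int p)"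
      "\<And>z h. z \<in> Z \<Longrightarrow> h \<in> carrier G \<Longrightarrow> [\<gamma> h z = 0] (mod int p)"
      using exists_cocycle [of S \<chi>] S \<chi> \<chi>S by blast
    have xl: "x l \<in> carrier G" using l by simp
    have "[\<gamma> v (x l) = \<gamma> (x l) v] (mod int p)" using no \<gamma>(1) xl by blast
    then have "[2 * (\<Sum>k<n. \<chi> k v * a k (x l)) = 0] (mod int p)"
      using \<gamma>(2,3) [OF v(1) xl] by (meson cong_sym cong_trans)
    moreover have "[2 * (\<Sum>k<n. \<chi> k v * a k (x l)) = 2 * (\<Sum>k<n. \<chi> k v * of_bool (k = l))] (mod int p)"
      using l by (intro cong_mult cong_sum cong_refl a_x) auto
    moreover have "(\<Sum>k<n. \<chi> k v * of_bool (k = l)) = \<chi> l v"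
      using l by (simp add: of_bool_def if_distrib cong: if_cong)
    ultimately have "[2 * \<chi> l v = 0] (mod int p)" by (metis cong_sym cong_trans)
    moreover have "coprime (int p) 2" using odd_p by simp
    ultimately show ?thesis by (simp add: cong_0_iff coprime_dvd_mult_right_iff)
  qed
  define Q where "Q l A \<longleftrightarrow> (\<forall>i j k. A i j k = - A j i k) \<and>
      (\<forall>i j k. i < n \<longrightarrow> j < n \<longrightarrow> k < n \<longrightarrow> [A i j k = - A i k j] (mod int p)) \<and>
      (\<forall>\<chi> q. hom_mod p G Z \<chi> \<longrightarrow> q < n \<longrightarrow>
        [(\<Sum>i<n. \<Sum>j<i. A i j q * \<chi> (c i j)) = of_bool (l = q) * \<chi> v] (mod int p))" for l A
  have "\<exists>A. Q l A" if l: "l < n" for l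
    unfolding Q_def
  proof (rule alternating_relations [where v = v and l = l])
    fix \<chi> S l
    assume "\<And>i j k. S i j k = S i k j" "\<And>k. k < n \<Longrightarrow> hom_mod p G Z (\<chi> k)"
      "\<And>i j k. i < n \<Longrightarrow> j < n \<Longrightarrow> k < n \<Longrightarrow> [\<chi> k (c i j) = S i j k - S j i k] (mod int p)" "l < n"
    then show "[\<chi> l v = 0] (mod int p)" by (rule van [where \<chi> = \<chi> and S = S and l = l])
  qed (use l in blast)+
  then obtain A where Q: "\<And>l. l < n \<Longrightarrow> Q l (A l)" by metis
  have A1: "A l i j k = - A l j i k" if "l < n" for l i j k
    using Q [OF that] unfolding Q_def by blast
  have A2: "[A l i j k = - A l i k j] (mod int p)" if "l < n" "i < n" "j < n" "k < n" for l i j k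
    using Q [OF that(1)] that unfolding Q_def by blast
  have A3: "[(\<Sum>i<n. \<Sum>j<i. A l i j q * \<chi> (c i j)) = of_bool (l = q) * \<chi> v] (mod int p)"
    if "l < n" "hom_mod p G Z \<chi>" "q < n" for l \<chi> q
    using Q [OF that(1)] that unfolding Q_def by blast
  let ?E = "edges v"
  \<comment> \<open>The 1 in the exponent stems from \<open>v\<close> and becomes the summand 1 in
    the argument of \<open>magidin_f\<close>.\<close>
  have "p ^ m \<le> p ^ (1 + ((n choose 2) - card ?E))" using card_derived_le [OF v(1)] m by simp
  then have "m \<le> 1 + ((n choose 2) - card ?E)"
    using power_le_imp_le_exp prime_gt_1_nat [OF prime_p] by blast
  \<comment> \<open>Ensures that the subtraction of \<open>card ?E\<close> does not
    truncate.\<close>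
  moreover have "card ?E \<le> n choose 2"
    using card_mono [OF finite_pairs edges_subset] n_subsets [of "{..<n}" 2] by simp
  ultimately have cE: "card ?E \<le> (n choose 2) - m + 1" by linarith
  have "n \<le> card (triangles ?E)" by (rule n_le_card_triangles [OF v A1 A2 A3])
  also have "\<dots> \<le> magidin_f (card ?E)"
    by (rule card_triangles_le [OF finite_edges]) (simp add: edges_def)
  also have "\<dots> \<le> magidin_f ((n choose 2) - m + 1)"
    using magidin_f_mono cE by (rule monoD)
  finally show False using f by simp
qed

end

text \<open>Coordinates with respect to a basis identify the group with the functions from the basis
  to the residues. Ranks enter the argument only through such orders.\<close>

lemma card_elementary_rank:
  assumes V: "vectorspace (residue_ring (int p)) (power_module A)" and fin: "finite (carrier A)"
  shows "card (carrier A) = p ^ elementary_rank p A"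
proof -
  let ?K = "residue_ring (int p)" and ?V = "power_module A"
  interpret V: vectorspace ?K ?V by (rule V)
  have carrier_V: "carrier ?V = carrier A" by (simp add: power_module_def)
  have card_K: "card (carrier ?K) = p" by (simp add: residue_ring_def)
  have "V.fin_dim"
    unfolding V.fin_dim_def
    using fin V.in_own_span [of "carrier ?V"] V.span_is_subset2 [of "carrier ?V"]
    by (intro exI [of _ "carrier ?V"]) (auto simp: carrier_V)
  then obtain B where B: "finite B" "V.basis B" using V.finite_basis_exists by blast
  then have B_sub: "B \<subseteq> carrier ?V" by (simp add: V.basis_def)
  have uniq: "\<exists>!a. a \<in> B \<rightarrow>\<^sub>E carrier ?K \<and> V.lincomb a B = v" if "v \<in> carrier ?V" for v
    using V.basis_criterion [OF B(1) B_sub] B(2) that by blast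
  have closed: "V.lincomb a B \<in> carrier ?V" if "a \<in> B \<rightarrow>\<^sub>E carrier ?K" for a
    using that B_sub by (intro V.lincomb_closed) (auto simp: PiE_def)
  have "bij_betw (\<lambda>a. V.lincomb a B) (B \<rightarrow>\<^sub>E carrier ?K) (carrier ?V)"
    unfolding bij_betw_def
  proof
    show "inj_on (\<lambda>a. V.lincomb a B) (B \<rightarrow>\<^sub>E carrier ?K)"
      using uniq closed by (intro inj_onI) blast
    show "(\<lambda>a. V.lincomb a B) ` (B \<rightarrow>\<^sub>E carrier ?K) = carrier ?V"
      using uniq closed by blast
  qed
  then have "card (carrier ?V) = card (B \<rightarrow>\<^sub>E carrier ?K)" by (rule bij_betw_same_card [symmetric])
  also have "\<dots> = p ^ card B" using B(1) by (simp add: card_PiE card_K)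
  also have "card B = elementary_rank p A"
    unfolding elementary_rank_def using V.dim_basis [OF B] by simp
  finally show ?thesis by (simp add: carrier_V)
qed

theorem corollary4p11:
  fixes G :: "('a, 'b) monoid_scheme" and p n m :: nat
  assumes "Factorial_Ring.prime p" and "odd p"
    and "group G" and "finite (carrier G)" and "\<exists>k. order G = p ^ k"
    and "nilpotency_class_at_most G 2"
    and "group_exponent G = p"
    and "n = elementary_rank p (G Mod group_center G)"
    and "m = elementary_rank p (G\<lparr>carrier := derived G (carrier G)\<rparr>)"
    and "magidin_f ((n choose 2) - m + 1) < n"
  shows "capable G"
proof -
  interpret group G by fact
  let ?Z = "group_center G" and ?D = "derived G (carrier G)"
  have DZ: "?D \<subseteq> ?Z" using assms(6) by (simp add: nilpotency_class_at_most_2_iff)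
  have exp: "x [^]\<^bsub>G\<^esub> p = \<one>\<^bsub>G\<^esub>" if "x \<in> carrier G" for x
    using group_exponent_pow [OF assms(3,4) that] assms(7) by simp
  interpret class_two_group G p
    by unfold_locales (use assms DZ exp in auto)
  have card_Z: "card (carrier G) = card (carrier (G Mod ?Z)) * card ?Z"
    using lagrange [OF group_center_subgroup] by (simp add: FactGroup_def order_def)
  have "finite (carrier (G Mod ?Z))"
    using finite_carrier by (simp add: FactGroup_def RCOSETS_def)
  then have card_Q: "card (carrier (G Mod ?Z)) = p ^ n"
    using card_elementary_rank [OF vectorspace_mod_center [OF assms(3,4,1,7,6)]] assms(8) by simp
  have "?D \<subseteq> carrier G" by (rule derived_in_carrier) simp
  then have "finite ?D" using finite_carrier by (rule finite_subset)
  then have card_D: "card ?D = p ^ m"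
    using card_elementary_rank [OF vectorspace_derived [OF assms(3,4,1,7,6)]] assms(9) by simp
  \<comment> \<open>The basis of G / Z(G) comes with its own length \<open>n'\<close>; since both
    \<open>p ^ n'\<close> and \<open>p ^ n\<close> are the index of the centre, it equals the
    rank.\<close>
  obtain n' x a where basis: "class_two_basis G p n' x a" and card: "card (carrier G) = p ^ n' * card ?Z"
    using exists_class_two_basis by blast
  have "card ?Z > 0"
    using finite_carrier subgroup.subset [OF group_center_subgroup] subgroup.one_closed [OF group_center_subgroup]
    by (metis card_gt_0_iff empty_iff finite_subset)
  with card card_Z card_Q have "p ^ n' = p ^ n" by simp
  then have "n' = n" using prime_gt_1_nat [OF assms(1)] by simp
  with basis interpret class_two_basis G p n x a by simp
  show ?thesis by (rule capable_if_few_relations [OF card_D assms(10)])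
qed

end
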